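(* Let $d\ge1$. Let $\alpha,\beta,\gamma\in\mathbb R\setminus\{0\}$ and $s\in\mathbb R$ satisfy one of the following, with $\mu=\alpha\beta\gamma\left(\frac1\alpha-\frac1\beta-\frac1\gamma\right)$: (i) $\alpha-\gamma=0$ and $s\ge0$; (ii) $\mu\le0$ and $s<1$. Then the flow map of the system $$(i\partial_t+\alpha\Delta)u=-(\nabla\cdot w)v,\quad (i\partial_t+\beta\Delta)v=-(\nabla\cdot\overline w)u,\quad (i\partial_t+\gamma\Delta)w=\nabla(u\cdot\overline v)\qquad (t>0,\ x\in\mathbb T^d)$$ fails to be locally uniformly continuous in $\mathcal H^s(\mathbb T^d)$. More precisely, there exist sequences $\{(u_n,v_n,w_n)\}$, $\{(\tilde u_n,\tilde v_n,\tilde w_n)\}$ of solutions of the system, a sequence $\{t_n\}$ of positive numbers, and constants $C,c>0$ such that $$\lim_{n\to\infty}t_n=0,$$ $$\sup_{n\in\mathbb N}\big(\|(u_n(0),v_n(0),w_n(0))\|_{\mathcal H^s}+\|(\tilde u_n(0),\tilde v_n(0),\tilde w_n(0))\|_{\mathcal H^s}\big)\le C,$$ $$\lim_{n\to\infty}\|(u_n(0),v_n(0),w_n(0))-(\tilde u_n(0),\tilde v_n(0),\tilde w_n(0))\|_{\mathcal H^s}=0,$$ $$\lim_{n\to\infty}\|(u_n(t_n),v_n(t_n),w_n(t_n))-(\tilde u_n(t_n),\tilde v_n(t_n),\tilde w_n(t_n))\|_{\mathcal H^s}\ge c.$$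
   Context: $\mathbb T=\mathbb R/2\pi\mathbb Z$; $u,v,w$ are $\mathbb C^d$-valued; $u\cdot\overline v=\sum_ju_j\overline{v_j}$. $\mathcal H^s(\mathbb T^d)=(H^s(\mathbb T^d))^d\times(H^s(\mathbb T^d))^d\times(H^s(\mathbb T^d))^d$. Solutions are understood as classical (smooth) solutions on a time interval containing $[0,t_n]$. The last limit is allowed to be $+\infty$. *)

theory Defs
  imports "HOL-Analysis.Analysis"
begin

text \<open>
  The dimension is \<open>d = CARD('n)\<close>. Functions on the torus are functions on \<open>real^'n\<close> that are
  \<open>2 * pi\<close>-periodic in every coordinate.
\<close>

definition periodic_torus :: "(real^'n \<Rightarrow> 'b) \<Rightarrow> bool" where
  "periodic_torus f \<longleftrightarrow> (\<forall>x j. f (x + (2 * pi) *\<^sub>R axis j 1) = f x)"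

section \<open>Sobolev norms\<close>

definition fourier_coeff :: "(real^'n \<Rightarrow> complex) \<Rightarrow> int^'n \<Rightarrow> complex" where
  "fourier_coeff f k =
     (LINT x:cbox 0 (\<chi> i. 2 * pi)|lborel. f x * cis (- (\<Sum>j\<in>UNIV. of_int (k $ j) * x $ j)))
       / of_real ((2 * pi) ^ CARD('n))"

definition sobolev_term :: "real \<Rightarrow> (real^'n \<Rightarrow> complex) \<Rightarrow> int^'n \<Rightarrow> real" where
  "sobolev_term s f k =
     (1 + (\<Sum>j\<in>UNIV. (of_int (k $ j))\<^sup>2)) powr s * (cmod (fourier_coeff f k))\<^sup>2"

text \<open>The norm is extended-real valued, so that a divergent series is not assigned a finite value.\<close>

definition sobolev_norm :: "real \<Rightarrow> (real^'n \<Rightarrow> complex) \<Rightarrow> ereal" where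
  "sobolev_norm s f =
     (if sobolev_term s f summable_on UNIV
      then ereal (sqrt (\<Sum>\<^sub>\<infinity>k. sobolev_term s f k)) else \<infinity>)"

text \<open>
  On the product \<open>(H\<^sup>s)\<^sup>d \<times> (H\<^sup>s)\<^sup>d \<times> (H\<^sup>s)\<^sup>d\<close> we take the sum of the norms of
  the \<open>3 * d\<close> components; all the usual product norms are equivalent to it.
\<close>

definition sobolev_norm_vec :: "real \<Rightarrow> (real^'n \<Rightarrow> complex^'n) \<Rightarrow> ereal" where
  "sobolev_norm_vec s f = (\<Sum>j\<in>UNIV. sobolev_norm s (\<lambda>x. f x $ j))"

definition Hs_norm ::
  "real \<Rightarrow> (real^'n \<Rightarrow> complex^'n) \<Rightarrow> (real^'n \<Rightarrow> complex^'n) \<Rightarrow> (real^'n \<Rightarrow> complex^'n) \<Rightarrow> ereal"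
  where
  "Hs_norm s u v w = sobolev_norm_vec s u + sobolev_norm_vec s v + sobolev_norm_vec s w"

section \<open>Differential operators\<close>

definition partial :: "'n \<Rightarrow> (real^'n \<Rightarrow> 'b::real_normed_vector) \<Rightarrow> real^'n \<Rightarrow> 'b" where
  "partial j f x = vector_derivative (\<lambda>h. f (x + h *\<^sub>R axis j 1)) (at 0)"

definition laplacian :: "(real^'n \<Rightarrow> 'b::real_normed_vector) \<Rightarrow> real^'n \<Rightarrow> 'b" where
  "laplacian f x = (\<Sum>j\<in>UNIV. partial j (partial j f) x)"

definition gradient :: "(real^'n \<Rightarrow> complex) \<Rightarrow> real^'n \<Rightarrow> complex^'n" where
  "gradient f x = (\<chi> j. partial j f x)"

definition divergence :: "(real^'n \<Rightarrow> complex^'n) \<Rightarrow> real^'n \<Rightarrow> complex" where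
  "divergence f x = (\<Sum>j\<in>UNIV. partial j (\<lambda>y. f y $ j) x)"

definition cnj_vec :: "complex^'n \<Rightarrow> complex^'n" where
  "cnj_vec z = (\<chi> j. cnj (z $ j))"

definition cdot :: "complex^'n \<Rightarrow> complex^'n \<Rightarrow> complex" where
  "cdot y z = (\<Sum>j\<in>UNIV. y $ j * z $ j)"

section \<open>Smooth solutions\<close>

text \<open>
  Derivatives are taken within \<open>S\<close>. We only use sets \<open>S = I \<times> UNIV\<close> with \<open>I\<close> a nondegenerate
  interval; there these derivatives are unique, and they are one-sided in time at the end points
  that belong to \<open>I\<close>.
\<close>

primrec Ck_on :: "nat \<Rightarrow> 'a::real_normed_vector set \<Rightarrow> ('a \<Rightarrow> 'b::real_normed_vector) \<Rightarrow> bool" where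
  "Ck_on 0 S f \<longleftrightarrow> continuous_on S f"
| "Ck_on (Suc k) S f \<longleftrightarrow>
     (\<exists>f'. (\<forall>x\<in>S. (f has_derivative f' x) (at x within S)) \<and> (\<forall>h. Ck_on k S (\<lambda>x. f' x h)))"

definition smooth_on :: "'a::real_normed_vector set \<Rightarrow> ('a \<Rightarrow> 'b::real_normed_vector) \<Rightarrow> bool" where
  "smooth_on S f \<longleftrightarrow> (\<forall>k. Ck_on k S f)"

definition smooth_torus_on :: "real set \<Rightarrow> (real \<Rightarrow> real^'n \<Rightarrow> complex^'n) \<Rightarrow> bool" where
  "smooth_torus_on I u \<longleftrightarrow>
     (\<forall>t\<in>I. periodic_torus (u t)) \<and> smooth_on (I \<times> UNIV) (\<lambda>(t, x). u t x)"

definition classical_solution_on ::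
  "real \<Rightarrow> real \<Rightarrow> real \<Rightarrow> real set \<Rightarrow> (real \<Rightarrow> real^'n \<Rightarrow> complex^'n) \<Rightarrow>
     (real \<Rightarrow> real^'n \<Rightarrow> complex^'n) \<Rightarrow> (real \<Rightarrow> real^'n \<Rightarrow> complex^'n) \<Rightarrow> bool" where
  "classical_solution_on \<alpha> \<beta> \<gamma> I u v w \<longleftrightarrow>
     smooth_torus_on I u \<and> smooth_torus_on I v \<and> smooth_torus_on I w \<and>
     (\<forall>t\<in>I. \<forall>x.
        \<i> *s vector_derivative (\<lambda>\<tau>. u \<tau> x) (at t within I) + \<alpha> *\<^sub>R laplacian (u t) x
          = - (divergence (w t) x *s v t x) \<and>
        \<i> *s vector_derivative (\<lambda>\<tau>. v \<tau> x) (at t within I) + \<beta> *\<^sub>R laplacian (v t) x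
          = - (divergence (\<lambda>y. cnj_vec (w t y)) x *s u t x) \<and>
        \<i> *s vector_derivative (\<lambda>\<tau>. w \<tau> x) (at t within I) + \<gamma> *\<^sub>R laplacian (w t) x
          = gradient (\<lambda>y. cdot (u t y) (cnj_vec (v t y))) x)"

definition classical_solution_up_to ::
  "real \<Rightarrow> real \<Rightarrow> real \<Rightarrow> real \<Rightarrow> (real \<Rightarrow> real^'n \<Rightarrow> complex^'n) \<Rightarrow>
     (real \<Rightarrow> real^'n \<Rightarrow> complex^'n) \<Rightarrow> (real \<Rightarrow> real^'n \<Rightarrow> complex^'n) \<Rightarrow> bool" where
  "classical_solution_up_to \<alpha> \<beta> \<gamma> T u v w \<longleftrightarrow>
     (\<exists>I. is_interval I \<and> {0..T} \<subseteq> I \<and> classical_solution_on \<alpha> \<beta> \<gamma> I u v w)"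

end

theory Submission
  imports Defs
begin

text \<open>
  A triad of plane waves \<open>u = \<i> x e\<^bsup>\<i>(k x\<^sub>j + \<Omega>\<^sub>1 t)\<^esup> e\<^sub>j\<close>, \<open>v = b e\<^bsup>\<i>(l x\<^sub>j + \<Omega>\<^sub>2 t)\<^esup> e\<^sub>j\<close>,
  \<open>w = c e\<^bsup>\<i>(m x\<^sub>j + \<Omega>\<^sub>3 t)\<^esup> e\<^sub>j\<close> with \<open>k = l + m\<close> is an exact solution as soon as three algebraic
  equations hold, and then its frequencies depend on its amplitudes. Scaling \<open>x\<close> by \<open>1 + \<delta>\<close>
  changes the data by \<open>O(\<delta>)\<close> but one of the frequencies by \<open>\<delta> \<sigma>\<close>, so that after the time
  \<open>\<pi> / (\<delta> \<sigma>)\<close> the two solutions have opposite phases in that component. It remains to find triads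
  of bounded \<open>H\<^sup>s\<close> norm with \<open>\<sigma>\<close> arbitrarily large. The number \<open>- \<mu>\<close> is a quarter of the discriminant
  of the resonance function \<open>\<alpha> (l + m)\<^sup>2 - \<beta> l\<^sup>2 - \<gamma> m\<^sup>2\<close>; for \<open>\<mu> \<le> 0\<close> it has a real root \<open>l / m = r\<close>,
  which is approximated by integers, with amplitudes of order \<open>m\<^bsup>- s\<^esup>\<close> and \<open>\<sigma>\<close> of order
  \<open>m\<^bsup>1 - s\<^esup>\<close>. If \<open>\<alpha> = \<gamma>\<close>, or if \<open>\<beta> = - \<gamma>\<close> and \<open>s \<le> 0\<close>, an exactly resonant triad in which
  \<open>v\<close>, respectively \<open>u\<close>, has frequency zero gives \<open>\<sigma>\<close> of order \<open>m\<close>.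
\<close>

text \<open>Longitudinal waves: the wave vector and the polarisation are both parallel to axis
  \<open>j\<close>. Divergence and gradient then act through the integer \<open>k\<close> alone,
  which reduces every dimension to one.\<close>

definition plane_wave :: "'n \<Rightarrow> int \<Rightarrow> complex \<Rightarrow> real^'n \<Rightarrow> complex^'n" where
  "plane_wave j k z x = axis j (z * cis (of_int k * x $ j))"

definition sobolev_weight :: "real \<Rightarrow> int \<Rightarrow> real" where
  "sobolev_weight s k = (1 + (of_int k)\<^sup>2) powr (s / 2)"

section \<open>Sobolev norms of plane waves\<close>

lemma cis_sum: "finite A \<Longrightarrow> cis (\<Sum>i\<in>A. f i) = (\<Prod>i\<in>A. cis (f i))"
  by (induction A rule: finite_induct) (auto simp: cis_mult[symmetric])

lemma integrable_cis_Icc: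
  "integrable lborel (\<lambda>t. indicator {a..b} t *\<^sub>R cis (r * t))"
proof -
  have "set_integrable lborel {a..b} (\<lambda>t. cis (r * t))"
    by (rule borel_integrable_atLeastAtMost') (intro continuous_intros)
  then show ?thesis by (simp add: set_integrable_def)
qed

lemma integral_cis_period:
  "(LINT t|lborel. indicator {0..2*pi} t *\<^sub>R cis (of_int n * t)) = (if n = 0 then of_real (2*pi) else 0)"
proof (cases "n = 0")
  case True
  then show ?thesis by (simp add: scaleR_conv_of_real)
next
  case False
  have "(LINT t|lborel. indicator {0..2*pi} t *\<^sub>R cis (of_int n * t))
      = - \<i> / of_int n * cis (of_int n * (2*pi)) - (- \<i> / of_int n * cis (of_int n * 0))"
  proof (rule integral_FTC_Icc)
    show "continuous_on {0..2 * pi} (\<lambda>t. cis (of_int n * t))" by (intro continuous_intros)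
    show "((\<lambda>t. - \<i> / of_int n * cis (of_int n * t)) has_vector_derivative cis (of_int n * x))
        (at x within {0..2*pi})" for x
      unfolding has_vector_derivative_def
      by (rule derivative_eq_intros refl | simp add: False scaleR_conv_of_real fun_eq_iff mult.left_commute[of \<i> "of_real _"])+
  qed simp
  also have "cis (of_int n * (2*pi)) = 1"
    by (metis Ints_of_int cis_multiple_2pi mult.commute)
  finally show ?thesis using False by simp
qed

text \<open>Orthogonality of characters: on the cube the integrand is a product of functions of one
  coordinate each, so the integral is a product of integrals over one period.\<close>

lemma integral_cis_torus:
  fixes \<kappa> :: "int^'n"
  shows "(LINT x:cbox 0 (\<chi> i. 2 * pi)|lborel. cis (\<Sum>i\<in>UNIV. of_int (\<kappa> $ i) * x $ i))
      = (if \<kappa> = 0 then of_real ((2*pi) ^ CARD('n)) else 0)"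
proof -
  let ?e = "\<lambda>i::'n. axis i (1::real)"
  have inj: "inj ?e" by (simp add: inj_on_def axis_eq_axis)
  have Basis: "(Basis :: (real^'n) set) = range ?e" by (auto simp: Basis_vec_def)
  \<comment> \<open>Indexed by basis vectors, since \<open>lborel\<close> on \<open>real^'n\<close>
    is the image of a product measure over \<open>Basis\<close>; \<open>axis_index\<close> recovers
    the coordinate.\<close>
  define h :: "real^'n \<Rightarrow> real \<Rightarrow> complex" where
    "h b t = indicator {0..2*pi} t *\<^sub>R cis (of_int (\<kappa> $ axis_index b) * t)" for b t
  have h: "h (?e i) t = indicator {0..2*pi} t *\<^sub>R cis (of_int (\<kappa> $ i) * t)" for i t
    by (simp add: h_def)
  have sum_nth: "(\<Sum>b\<in>Basis. f b *\<^sub>R b) $ i = f (?e i)" for f :: "real^'n \<Rightarrow> real" and i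
  proof -
    have "(\<Sum>b\<in>Basis. f b *\<^sub>R b) $ i = (\<Sum>b\<in>Basis. f b *\<^sub>R b) \<bullet> ?e i"
      by (simp add: cart_eq_inner_axis)
    also have "\<dots> = f (?e i)" by (rule inner_sum_left_Basis) simp
    finally show ?thesis .
  qed
  have split: "indicator (cbox 0 (\<chi> i. 2 * pi)) x *\<^sub>R cis (\<Sum>i\<in>UNIV. of_int (\<kappa> $ i) * x $ i)
      = (\<Prod>i\<in>UNIV. h (?e i) (x $ i))" for x
  proof (cases "x \<in> cbox 0 (\<chi> i. 2 * pi)")
    case True
    then have "\<forall>i. x $ i \<in> {0..2*pi}" by (auto simp: mem_box_cart)
    with True show ?thesis by (simp add: h cis_sum)
  next
    case False
    then obtain i where "x $ i \<notin> {0..2*pi}" by (auto simp: mem_box_cart)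
    then have "h (?e i) (x $ i) = 0" by (simp add: h)
    with False show ?thesis by (auto intro!: prod_zero[symmetric])
  qed
  have meas [measurable]: "h b \<in> borel_measurable borel" for b
    unfolding h_def by (rule borel_measurable_scaleR)
      (auto intro!: borel_measurable_continuous_onI continuous_intros)
  interpret product_sigma_finite "\<lambda>_::real^'n. lborel :: real measure" ..
  have "(LINT x:cbox 0 (\<chi> i. 2 * pi)|lborel. cis (\<Sum>i\<in>UNIV. of_int (\<kappa> $ i) * x $ i))
      = (LINT x|lborel. (\<Prod>i\<in>UNIV. h (?e i) (x $ i)))"
    by (simp add: set_lebesgue_integral_def split)
  also have "\<dots> = (LINT x|lborel. (\<Prod>b\<in>Basis. h b (x \<bullet> b)))"
    unfolding Basis by (subst prod.reindex[OF inj]) (simp add: cart_eq_inner_axis)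
  also have "\<dots> = (LINT f|(\<Pi>\<^sub>M b\<in>Basis. lborel). (\<Prod>b\<in>Basis. h b ((\<Sum>b\<in>Basis. f b *\<^sub>R b) \<bullet> b)))"
    by (subst lborel_eq, subst integral_distr) auto
  also have "\<dots> = (LINT f|(\<Pi>\<^sub>M b\<in>Basis. lborel). (\<Prod>b\<in>(Basis::(real^'n) set). h b (f b)))"
    by (intro Bochner_Integration.integral_cong prod.cong refl) (simp add: inner_sum_left_Basis)
  also have "\<dots> = (\<Prod>b\<in>Basis. integral\<^sup>L lborel (h b))"
    by (rule product_integral_prod) (auto simp: h_def integrable_cis_Icc)
  also have "\<dots> = (\<Prod>i\<in>UNIV. integral\<^sup>L lborel (h (?e i)))"
    unfolding Basis by (subst prod.reindex[OF inj]) simp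
  also have "\<dots> = (\<Prod>i\<in>(UNIV::'n set). if \<kappa> $ i = 0 then of_real (2*pi) else 0)"
    proof (rule prod.cong[OF refl])
    fix i :: 'n
    have "h (?e i) = (\<lambda>t. indicator {0..2*pi} t *\<^sub>R cis (of_int (\<kappa> $ i) * t))"
      by (rule ext) (rule h)
    then show "integral\<^sup>L lborel (h (?e i)) = (if \<kappa> $ i = 0 then of_real (2*pi) else 0)"
      by (simp only: integral_cis_period)
  qed
  also have "\<dots> = (if \<kappa> = 0 then of_real ((2*pi) ^ CARD('n)) else 0)"
    by (auto simp: vec_eq_iff)
  finally show ?thesis .
qed

lemma fourier_coeff_exponential:
  fixes j :: "'n::finite"
  shows "fourier_coeff (\<lambda>x. z * cis (of_int k * x $ j)) \<kappa> = (if \<kappa> = axis j k then z else 0)"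
proof -
  have "z * cis (of_int k * x $ j) * cis (- (\<Sum>i\<in>UNIV. of_int (\<kappa> $ i) * x $ i))
     = z * cis (\<Sum>i\<in>UNIV. of_int ((axis j k - \<kappa>) $ i) * x $ i)" for x :: "real^'n"
  proof -
    have "of_int k * x $ j = (\<Sum>i\<in>UNIV. of_int (axis j k $ i) * x $ i)"
      by (simp add: axis_def if_distrib[where f=of_int] if_distrib[where f="\<lambda>a. a * _"] cong: if_cong)
    then show ?thesis
      by (simp add: cis_mult sum_subtractf[symmetric] left_diff_distrib mult.assoc)
  qed
  then have "fourier_coeff (\<lambda>x. z * cis (of_int k * x $ j)) \<kappa> =
     z * (LINT x:cbox 0 (\<chi> i. 2 * pi)|lborel. cis (\<Sum>i\<in>UNIV. of_int ((axis j k - \<kappa>) $ i) * x $ i))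
       / of_real ((2 * pi) ^ CARD('n))"
    unfolding fourier_coeff_def by (simp only: mult.assoc set_integral_mult_right)
  then show ?thesis unfolding integral_cis_torus by auto
qed

lemma sobolev_norm_exponential:
  fixes j :: "'n::finite"
  shows "sobolev_norm s (\<lambda>x::real^'n. z * cis (of_int k * x $ j)) = ereal (sobolev_weight s k * cmod z)"
proof -
  let ?f = "\<lambda>x::real^'n. z * cis (of_int k * x $ j)"
  have sq: "(\<Sum>i\<in>UNIV. (real_of_int (axis j k $ i))\<^sup>2) = (of_int k)\<^sup>2"
    by (simp add: axis_def if_distrib[where f=of_int] if_distrib[where f="\<lambda>a. a^2"] cong: if_cong)
  have terms: "sobolev_term s ?f \<kappa> = (if \<kappa> = axis j k then (sobolev_weight s k * cmod z)\<^sup>2 else 0)" for \<kappa>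
  proof -
    have "((1 + (of_int k)\<^sup>2) powr (s / 2))\<^sup>2 = (1 + (real_of_int k)\<^sup>2) powr s"
      by (simp add: power2_eq_square powr_add[symmetric])
    then show ?thesis
      by (auto simp: sobolev_term_def fourier_coeff_exponential sq sobolev_weight_def power_mult_distrib)
  qed
  have "(sobolev_term s ?f has_sum (sobolev_weight s k * cmod z)\<^sup>2) UNIV"
    by (rule has_sum_finite_neutralI[where B="{axis j k}"]) (auto simp: terms)
  then show ?thesis
    by (auto simp: sobolev_norm_def has_sum_imp_summable infsumI sobolev_weight_def)
qed

lemma sobolev_norm_vec_plane_wave:
  "sobolev_norm_vec s (plane_wave j k z) = ereal (sobolev_weight s k * cmod z)"
proof -
  have "sobolev_norm s (\<lambda>x. plane_wave j k z x $ i)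
      = (if i = j then ereal (sobolev_weight s k * cmod z) else 0)" for i
    \<comment> \<open>The components other than \<open>j\<close> are exponentials of amplitude
      zero.\<close>
    using sobolev_norm_exponential[of s z k j] sobolev_norm_exponential[of s 0 0 j]
    by (simp add: plane_wave_def axis_def)
  then show ?thesis by (simp add: sobolev_norm_vec_def)
qed

lemma Hs_norm_plane_wave:
  "Hs_norm s (plane_wave j k a) (plane_wave j l b) (plane_wave j m c)
   = ereal (sobolev_weight s k * cmod a + sobolev_weight s l * cmod b + sobolev_weight s m * cmod c)"
  by (simp add: Hs_norm_def sobolev_norm_vec_plane_wave)

lemma plane_wave_diff:
  "(\<lambda>x. plane_wave j k a x - plane_wave j k b x) = plane_wave j k (a - b)"
  by (auto simp: plane_wave_def fun_eq_iff vec_eq_iff axis_def algebra_simps)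

section \<open>Plane waves as smooth solutions\<close>

text \<open>The family is closed under directional derivatives: differentiating along
  \<open>h\<close> replaces the pair \<open>v\<close>, \<open>w\<close> by \<open>w\<close>,
  \<open>- v\<close>, times \<open>L h\<close>. Induction for all \<open>v\<close> and
  \<open>w\<close> at once therefore reaches every order.\<close>

lemma Ck_on_cos_sin:
  fixes L :: "'a::real_normed_vector \<Rightarrow> real" and v w :: "'b::real_normed_vector"
  assumes L: "bounded_linear L"
  shows "Ck_on n S (\<lambda>p. cos (L p) *\<^sub>R v + sin (L p) *\<^sub>R w)"
proof (induction n arbitrary: v w)
  case 0
  show ?case
    unfolding Ck_on.simps
    by (intro continuous_on_add continuous_on_scaleR continuous_on_cos continuous_on_sin
        continuous_on_const linear_continuous_on L)
next
  case (Suc n)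
  let ?f' = "\<lambda>p h. L h *\<^sub>R (cos (L p) *\<^sub>R w + sin (L p) *\<^sub>R (- v))"
  have "((\<lambda>p. cos (L p) *\<^sub>R v + sin (L p) *\<^sub>R w) has_derivative ?f' p) (at p within S)" for p
  proof -
    have "((\<lambda>p. cos (L p) *\<^sub>R v + sin (L p) *\<^sub>R w) has_derivative
        (\<lambda>h. (- sin (L p) * L h) *\<^sub>R v + (cos (L p) * L h) *\<^sub>R w)) (at p within S)"
      by (auto intro!: derivative_eq_intros bounded_linear_imp_has_derivative L simp: mult.commute)
    then show ?thesis by (simp add: algebra_simps)
  qed
  moreover have "Ck_on n S (\<lambda>p. ?f' p h)" for h
    using Suc[of "L h *\<^sub>R w" "L h *\<^sub>R (- v)"] by (simp add: algebra_simps)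
  ultimately show ?case
    unfolding Ck_on.simps by (intro exI[of _ ?f']) blast
qed

lemma linear_axis: "linear (axis j :: complex \<Rightarrow> complex^'n)"
  by (rule linearI) (auto simp: axis_def vec_eq_iff)

lemma has_vector_derivative_axis:
  fixes f :: "real \<Rightarrow> complex"
  assumes "(f has_vector_derivative f') F"
  shows "((\<lambda>t. axis j (f t) :: complex^'n) has_vector_derivative axis j f') F"
  using bounded_linear.has_vector_derivative[OF _ assms] linear_axis linear_conv_bounded_linear
  by blast

lemma smooth_torus_on_plane_wave:
  "smooth_torus_on I (\<lambda>t. plane_wave j k (z * cis (\<Omega> * t)) :: real^'n \<Rightarrow> complex^'n)"
proof -
  let ?L = "\<lambda>p :: real \<times> (real^'n). \<Omega> * fst p + of_int k * snd p $ j"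
  have "bounded_linear ?L"
    by (intro bounded_linear_add bounded_linear_const_mult bounded_linear_fst
        bounded_linear_compose[OF bounded_linear_vec_nth bounded_linear_snd])
  \<comment> \<open>The phase is linear in the space-time variable and multiplication by
    \<open>\<i>\<close> is a quarter turn, which gives the cosine-sine form over the reals.\<close>
  moreover have "(\<lambda>(t, x). plane_wave j k (z * cis (\<Omega> * t)) x)
      = (\<lambda>p. cos (?L p) *\<^sub>R axis j z + sin (?L p) *\<^sub>R axis j (\<i> * z))"
    by (auto simp: plane_wave_def fun_eq_iff vec_eq_iff axis_def mult.assoc cis_mult)
       (simp add: complex_eq_iff algebra_simps)
  ultimately have "smooth_on (I \<times> UNIV) (\<lambda>(t, x). plane_wave j k (z * cis (\<Omega> * t)) x)"
    unfolding smooth_on_def by (simp add: Ck_on_cos_sin)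
  moreover have "periodic_torus (plane_wave j k c :: real^'n \<Rightarrow> complex^'n)" for c
  proof -
    have "cis (of_int k * (y + 2 * pi)) = cis (of_int k * y)" for y
      using cis_multiple_2pi[of "of_int k"] by (simp add: distrib_left cis_mult[symmetric] mult.commute mult.left_commute)
    moreover have "(x + (2 * pi) *\<^sub>R axis i 1) $ j = x $ j + (if i = j then 2 * pi else 0)"
      for x :: "real^'n" and i by (simp add: axis_def)
    ultimately show ?thesis
      unfolding periodic_torus_def plane_wave_def by auto
  qed
  ultimately show ?thesis by (simp add: smooth_torus_on_def)
qed

section \<open>Action of the differential operators on plane waves\<close>

lemma has_vector_derivative_cis_linear:
  "((\<lambda>t. z * cis (r * t)) has_vector_derivative \<i> * of_real r * (z * cis (r * t))) (at t within S)"
  unfolding has_vector_derivative_def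
  by (rule derivative_eq_intros refl
      | simp add: scaleR_conv_of_real fun_eq_iff)+

lemma exponential_directional_derivative:
  fixes x :: "real^'n"
  shows "((\<lambda>h. z * cis (of_int k * (x + h *\<^sub>R axis i 1) $ j)) has_vector_derivative
      (if i = j then \<i> * of_int k * z else 0) * cis (of_int k * x $ j)) (at 0)"
proof (cases "i = j")
  case True
  then show ?thesis
    using has_vector_derivative_cis_linear[of "z * cis (of_int k * x $ j)" "of_int k" 0 UNIV]
    by (simp add: distrib_left cis_mult[symmetric] mult.assoc)
next
  case False
  then show ?thesis by (simp add: axis_def)
qed

lemma partial_exponential:
  fixes j :: "'n::finite"
  shows "partial i (\<lambda>x. z * cis (of_int k * x $ j)) =
    (\<lambda>x. (if i = j then \<i> * of_int k * z else 0) * cis (of_int k * x $ j))"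
  unfolding partial_def
  by (intro ext vector_derivative_at exponential_directional_derivative)

lemma partial_plane_wave:
  "partial i (plane_wave j k z) = plane_wave j k (if i = j then \<i> * of_int k * z else 0)"
  unfolding partial_def plane_wave_def
  by (intro ext vector_derivative_at has_vector_derivative_axis exponential_directional_derivative)

lemma plane_wave_0: "plane_wave j k 0 x = 0"
  by (simp add: plane_wave_def)

lemma laplacian_plane_wave:
  "laplacian (plane_wave j k z) x = plane_wave j k (- (of_int k)\<^sup>2 * z) x"
proof -
  have "partial i (partial i (plane_wave j k z)) x
      = (if i = j then plane_wave j k (- (of_int k)\<^sup>2 * z) x else 0)" for i
    by (simp add: partial_plane_wave plane_wave_0 power2_eq_square mult.left_commute mult.assoc)
  then show ?thesis by (simp add: laplacian_def)
qed

lemma divergence_plane_wave: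
  "divergence (plane_wave j k z) x = \<i> * of_int k * z * cis (of_int k * x $ j)"
proof -
  have "partial i (\<lambda>y. plane_wave j k z y $ i) x
      = (if i = j then \<i> * of_int k * z * cis (of_int k * x $ j) else 0)" for i
    using partial_exponential[of i z k j] partial_exponential[of i 0 k j]
    by (cases "i = j") (simp_all add: plane_wave_def axis_def)
  then show ?thesis by (simp add: divergence_def)
qed

lemma cnj_vec_plane_wave: "cnj_vec (plane_wave j k z x) = plane_wave j (- k) (cnj z) x"
  by (simp add: cnj_vec_def plane_wave_def axis_def vec_eq_iff cis_cnj)

text \<open>Only component \<open>j\<close> of either field is nonzero, so the pairing is a scalar
  exponential of frequency \<open>k - l\<close>, and its gradient points along axis \<open>j\<close>
  again. This keeps the triad closed under the third nonlinearity.\<close>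

lemma gradient_plane_waves:
  "gradient (\<lambda>y. cdot (plane_wave j k a y) (cnj_vec (plane_wave j l b y))) x
   = plane_wave j (k - l) (\<i> * of_int (k - l) * (a * cnj b)) x"
proof -
  have "cdot (plane_wave j k a y) (cnj_vec (plane_wave j l b y))
      = a * cnj b * cis (of_int (k - l) * y $ j)" for y
  proof -
    have "cdot (plane_wave j k a y) (cnj_vec (plane_wave j l b y))
        = (\<Sum>i\<in>UNIV. if i = j then a * cnj b * (cis (of_int k * y $ j) * cis (- of_int l * y $ j)) else 0)"
      unfolding cdot_def cnj_vec_plane_wave by (rule sum.cong) (auto simp: plane_wave_def axis_def)
    then show ?thesis by (simp add: cis_mult algebra_simps)
  qed
  then show ?thesis
    unfolding gradient_def
    by (simp add: partial_exponential plane_wave_def vec_eq_iff axis_def del: of_int_diff)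
qed

lemma scalar_mult_plane_wave:
  "(c * cis (of_int m * x $ j)) *s plane_wave j l b x = plane_wave j (l + m) (c * b) x"
  by (simp add: plane_wave_def axis_def vec_eq_iff cis_mult[symmetric] distrib_right)

lemma plane_wave_linear:
  "plane_wave j k a x + plane_wave j k b x = plane_wave j k (a + b) x"
  "- plane_wave j k a x = plane_wave j k (- a) x"
  "\<i> *s plane_wave j k a x = plane_wave j k (\<i> * a) x"
  "r *\<^sub>R plane_wave j k a x = plane_wave j k (of_real r * a) x"
  by (auto simp: plane_wave_def axis_def vec_eq_iff algebra_simps
      scaleR_conv_of_real[where 'a=complex])

lemma vector_derivative_plane_wave:
  "vector_derivative (\<lambda>t. plane_wave j k (z * cis (\<Omega> * t)) x) (at t)
   = plane_wave j k (\<i> * of_real \<Omega> * (z * cis (\<Omega> * t))) x"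
  unfolding plane_wave_def
  using has_vector_derivative_cis_linear[of "z * cis (of_int k * x $ j)" \<Omega> t UNIV]
  by (intro vector_derivative_at has_vector_derivative_axis) (simp add: mult_ac)

text \<open>
  A single triad of plane waves is invariant under the flow. The factor \<open>\<i>\<close> in the first amplitude
  makes the three amplitude equations real.
\<close>

lemma classical_solution_plane_waves:
  fixes j :: "'n::finite"
  assumes "k = l + m" and "\<Omega>\<^sub>1 = \<Omega>\<^sub>2 + \<Omega>\<^sub>3"
    and eq1: "(\<Omega>\<^sub>1 + \<alpha> * (of_int k)\<^sup>2) * a = of_int m * b * c"
    and eq2: "(\<Omega>\<^sub>2 + \<beta> * (of_int l)\<^sup>2) * b = of_int m * a * c"
    and eq3: "(\<Omega>\<^sub>3 + \<gamma> * (of_int m)\<^sup>2) * c = of_int m * a * b"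
  shows "classical_solution_up_to \<alpha> \<beta> \<gamma> T
    (\<lambda>t. plane_wave j k (\<i> * of_real a * cis (\<Omega>\<^sub>1 * t)))
    (\<lambda>t. plane_wave j l (of_real b * cis (\<Omega>\<^sub>2 * t)))
    (\<lambda>t. plane_wave j m (of_real c * cis (\<Omega>\<^sub>3 * t)))"
proof -
  note simps = laplacian_plane_wave divergence_plane_wave cnj_vec_plane_wave gradient_plane_waves
    scalar_mult_plane_wave plane_wave_linear vector_derivative_plane_wave
  have eqs: "complex_of_real ((\<Omega>\<^sub>1 + \<alpha> * (of_int k)\<^sup>2) * a) = of_real (of_int m * b * c)"
    "complex_of_real ((\<Omega>\<^sub>2 + \<beta> * (of_int l)\<^sup>2) * b) = of_real (of_int m * a * c)"
    "complex_of_real ((\<Omega>\<^sub>3 + \<gamma> * (of_int m)\<^sup>2) * c) = of_real (of_int m * a * b)"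
    using eq1 eq2 eq3 by simp_all
  \<comment> \<open>By the relation between the three time frequencies, each nonlinear term
    oscillates exactly like the linear part of its own equation; only amplitude equations
    remain.\<close>
  have cis1: "cis (\<Omega>\<^sub>3 * t) * cis (\<Omega>\<^sub>2 * t) = cis (\<Omega>\<^sub>1 * t)"
    "cis (- (\<Omega>\<^sub>3 * t)) * cis (\<Omega>\<^sub>1 * t) = cis (\<Omega>\<^sub>2 * t)"
    "cis (\<Omega>\<^sub>1 * t) * cis (- (\<Omega>\<^sub>2 * t)) = cis (\<Omega>\<^sub>3 * t)" for t
    using assms(2) by (simp_all add: cis_mult algebra_simps)
  show ?thesis
    unfolding classical_solution_up_to_def classical_solution_on_def
  \<comment> \<open>The solution is global, so the whole real line serves as time interval and the
    time derivatives are two-sided.\<close>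
  proof (intro exI[of _ UNIV] conjI ballI allI)
    fix t :: real and x :: "real^'n"
    show "\<i> *s vector_derivative (\<lambda>t. plane_wave j k (\<i> * of_real a * cis (\<Omega>\<^sub>1 * t)) x) (at t)
        + \<alpha> *\<^sub>R laplacian (plane_wave j k (\<i> * of_real a * cis (\<Omega>\<^sub>1 * t))) x
      = - (divergence (plane_wave j m (of_real c * cis (\<Omega>\<^sub>3 * t))) x
          *s plane_wave j l (of_real b * cis (\<Omega>\<^sub>2 * t)) x)"
    proof -
      have "\<i> * (\<i> * of_real \<Omega>\<^sub>1 * (\<i> * of_real a * cis (\<Omega>\<^sub>1 * t)))
          + of_real \<alpha> * (- (of_int k)\<^sup>2 * (\<i> * of_real a * cis (\<Omega>\<^sub>1 * t)))
        = - \<i> * of_real ((\<Omega>\<^sub>1 + \<alpha> * (of_int k)\<^sup>2) * a) * cis (\<Omega>\<^sub>1 * t)"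
        by (simp add: algebra_simps)
      also have "\<dots> = - (\<i> * of_int m * (of_real c * cis (\<Omega>\<^sub>3 * t)) * (of_real b * cis (\<Omega>\<^sub>2 * t)))"
        unfolding eqs cis1(1)[symmetric] by (simp add: algebra_simps)
      finally show ?thesis using assms(1) by (simp add: simps)
    qed
    show "\<i> *s vector_derivative (\<lambda>t. plane_wave j l (of_real b * cis (\<Omega>\<^sub>2 * t)) x) (at t)
        + \<beta> *\<^sub>R laplacian (plane_wave j l (of_real b * cis (\<Omega>\<^sub>2 * t))) x
      = - (divergence (\<lambda>y. cnj_vec (plane_wave j m (of_real c * cis (\<Omega>\<^sub>3 * t)) y)) x
          *s plane_wave j k (\<i> * of_real a * cis (\<Omega>\<^sub>1 * t)) x)"
    proof -
      have "\<i> * (\<i> * of_real \<Omega>\<^sub>2 * (of_real b * cis (\<Omega>\<^sub>2 * t)))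
          + of_real \<beta> * (- (of_int l)\<^sup>2 * (of_real b * cis (\<Omega>\<^sub>2 * t)))
        = - of_real ((\<Omega>\<^sub>2 + \<beta> * (of_int l)\<^sup>2) * b) * cis (\<Omega>\<^sub>2 * t)"
        by (simp add: algebra_simps)
      also have "\<dots> = - (\<i> * of_int (- m) * cnj (of_real c * cis (\<Omega>\<^sub>3 * t))
          * (\<i> * of_real a * cis (\<Omega>\<^sub>1 * t)))"
        unfolding eqs cis1(2)[symmetric] by (simp add: algebra_simps cis_cnj)
      finally show ?thesis using assms(1) by (simp add: simps del: of_int_minus complex_cnj_mult)
    qed
    show "\<i> *s vector_derivative (\<lambda>t. plane_wave j m (of_real c * cis (\<Omega>\<^sub>3 * t)) x) (at t)
        + \<gamma> *\<^sub>R laplacian (plane_wave j m (of_real c * cis (\<Omega>\<^sub>3 * t))) x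
      = gradient (\<lambda>y. cdot (plane_wave j k (\<i> * of_real a * cis (\<Omega>\<^sub>1 * t)) y)
          (cnj_vec (plane_wave j l (of_real b * cis (\<Omega>\<^sub>2 * t)) y))) x"
    proof -
      have "\<i> * (\<i> * of_real \<Omega>\<^sub>3 * (of_real c * cis (\<Omega>\<^sub>3 * t)))
          + of_real \<gamma> * (- (of_int m)\<^sup>2 * (of_real c * cis (\<Omega>\<^sub>3 * t)))
        = - of_real ((\<Omega>\<^sub>3 + \<gamma> * (of_int m)\<^sup>2) * c) * cis (\<Omega>\<^sub>3 * t)"
        by (simp add: algebra_simps)
      also have "\<dots> = \<i> * of_int m * (\<i> * of_real a * cis (\<Omega>\<^sub>1 * t)
          * cnj (of_real b * cis (\<Omega>\<^sub>2 * t)))"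
        unfolding eqs cis1(3)[symmetric] by (simp add: algebra_simps cis_cnj)
      finally show ?thesis using assms(1) by (simp add: simps del: complex_cnj_mult cnj_vec_plane_wave)
    qed
  qed (simp_all add: smooth_torus_on_plane_wave)
qed

section \<open>Perturbing a resonant triad\<close>

text \<open>
  The amplitudes are parametrised as \<open>x\<close>, \<open>p * g\<close>, \<open>p / g\<close>; for given \<open>x\<close> and \<open>g\<close>, the condition
  on \<open>p\<close> absorbs the resonance defect \<open>m * \<epsilon>\<close>.
\<close>

lemma triad_solution:
  fixes j :: "'n::finite"
  assumes k: "k = l + m" and "x > 0" "g > 0"
    and p: "p\<^sup>2 = (g\<^sup>2 + 1 / g\<^sup>2) * x\<^sup>2 + \<epsilon> * x"
    and \<epsilon>: "of_int m * \<epsilon> = \<alpha> * (of_int k)\<^sup>2 - \<beta> * (of_int l)\<^sup>2 - \<gamma> * (of_int m)\<^sup>2"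
  shows "classical_solution_up_to \<alpha> \<beta> \<gamma> T
    (\<lambda>t. plane_wave j k (\<i> * of_real x
        * cis ((of_int m * ((g\<^sup>2 + 1 / g\<^sup>2) * x + \<epsilon>) - \<alpha> * (of_int k)\<^sup>2) * t)))
    (\<lambda>t. plane_wave j l (of_real (p * g) * cis ((of_int m * x / g\<^sup>2 - \<beta> * (of_int l)\<^sup>2) * t)))
    (\<lambda>t. plane_wave j m (of_real (p / g) * cis ((of_int m * x * g\<^sup>2 - \<gamma> * (of_int m)\<^sup>2) * t)))"
proof (rule classical_solution_plane_waves[OF k])
  \<comment> \<open>The time frequencies add up precisely because \<open>m * \<epsilon>\<close> is
    the resonance defect.\<close>
  show "of_int m * ((g\<^sup>2 + 1 / g\<^sup>2) * x + \<epsilon>) - \<alpha> * (of_int k)\<^sup>2 =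
      of_int m * x / g\<^sup>2 - \<beta> * (of_int l)\<^sup>2 + (of_int m * x * g\<^sup>2 - \<gamma> * (of_int m)\<^sup>2)"
    using \<epsilon> by (simp add: algebra_simps)
  have "(p * g) * (p / g) = ((g\<^sup>2 + 1 / g\<^sup>2) * x + \<epsilon>) * x"
  proof -
    have "(p * g) * (p / g) = p\<^sup>2" using \<open>g > 0\<close> by (simp add: power2_eq_square)
    then show ?thesis unfolding p by (simp add: power2_eq_square algebra_simps)
  qed
  then show "(of_int m * ((g\<^sup>2 + 1 / g\<^sup>2) * x + \<epsilon>) - \<alpha> * (of_int k)\<^sup>2 + \<alpha> * (of_int k)\<^sup>2) * x
      = of_int m * (p * g) * (p / g)"
    by (simp only: mult.assoc diff_add_cancel)
  \<comment> \<open>These two amplitude equations hold for every \<open>p\<close>, since the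
    quotient of the amplitudes \<open>p * g\<close> and \<open>p / g\<close> is
    \<open>g\<^sup>2\<close>. Only the first equation constrains \<open>p\<close>.\<close>
  show "(of_int m * x / g\<^sup>2 - \<beta> * (of_int l)\<^sup>2 + \<beta> * (of_int l)\<^sup>2) * (p * g) = of_int m * x * (p / g)"
    "(of_int m * x * g\<^sup>2 - \<gamma> * (of_int m)\<^sup>2 + \<gamma> * (of_int m)\<^sup>2) * (p / g) = of_int m * x * (p * g)"
    using \<open>g > 0\<close> by (simp_all add: power2_eq_square)
qed

text \<open>A relative phase of half a turn makes the amplitudes add instead of cancel. The
  unimodular factor \<open>\<zeta>\<close> covers both the factor \<open>\<i>\<close> of the first
  field and the factor 1 of the others.\<close>

lemma cmod_opposite_phases:
  assumes "a \<ge> 0" "a' \<ge> 0" "cmod \<zeta> = 1" "\<omega>' * t = \<omega> * t + pi"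
  shows "cmod (\<zeta> * of_real a * cis (\<omega> * t) - \<zeta> * of_real a' * cis (\<omega>' * t)) = a + a'"
proof -
  have "\<zeta> * of_real a * cis (\<omega> * t) - \<zeta> * of_real a' * cis (\<omega>' * t)
      = \<zeta> * of_real (a + a') * cis (\<omega> * t)"
    unfolding assms(4) by (simp add: cis_mult[symmetric] algebra_simps)
  also have "cmod \<dots> = a + a'"
    using assms by (simp only: norm_mult norm_cis norm_of_real) simp
  finally show ?thesis .
qed

text \<open>The new right-hand side factors as \<open>(1 + \<delta>) * x * (\<kappa> * x +
  \<epsilon> + \<delta> * (\<kappa> * x))\<close>. From
  \<open>\<kappa> * x \<ge> 2 * x \<ge> 2 * |\<epsilon>|\<close>, the defect removes at most half of
  \<open>\<kappa> * x\<close>, so both factors grow by a ratio of at most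
  \<open>1 + 2 * \<delta>\<close>, and so does the square root.\<close>

lemma amplitude_perturbation:
  fixes x \<kappa> \<epsilon> \<delta> p :: real
  assumes "x > 0" "\<kappa> \<ge> 2" "\<bar>\<epsilon>\<bar> \<le> x" "\<delta> \<ge> 0" "p \<ge> 0" and p: "p\<^sup>2 = \<kappa> * x\<^sup>2 + \<epsilon> * x"
  obtains p' where "p'\<^sup>2 = \<kappa> * ((1 + \<delta>) * x)\<^sup>2 + \<epsilon> * ((1 + \<delta>) * x)" "p \<le> p'" "p' \<le> (1 + 2 * \<delta>) * p"
proof
  define q where "q = \<kappa> * ((1 + \<delta>) * x)\<^sup>2 + \<epsilon> * ((1 + \<delta>) * x)"
  have \<kappa>x: "2 * x \<le> \<kappa> * x" using assms by simp
  then have pos: "0 \<le> \<kappa> * x + \<epsilon>" using assms by linarith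
  have q: "q = (1 + \<delta>) * x * (\<kappa> * x + \<epsilon> + \<delta> * (\<kappa> * x))"
    by (simp add: q_def power2_eq_square algebra_simps)
  have p2: "p\<^sup>2 = x * (\<kappa> * x + \<epsilon>)" using p by (simp add: power2_eq_square algebra_simps)
  have "x * (\<kappa> * x + \<epsilon>) \<le> (1 + \<delta>) * x * (\<kappa> * x + \<epsilon> + \<delta> * (\<kappa> * x))"
    using assms pos by (intro mult_mono) (auto simp: mult_le_cancel_right1)
  then have lower: "p\<^sup>2 \<le> q" using p2 q by simp
  have "\<delta> * (\<kappa> * x) \<le> \<delta> * (2 * (\<kappa> * x + \<epsilon>))"
  proof (rule mult_left_mono)
    have "y \<le> 2 * (y + \<epsilon>)" if "2 * x \<le> y" for y using that abs_le_D2[OF \<open>\<bar>\<epsilon>\<bar> \<le> x\<close>] by simp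
    then show "\<kappa> * x \<le> 2 * (\<kappa> * x + \<epsilon>)" using \<kappa>x by blast
  qed fact
  moreover have "0 \<le> \<kappa> * x + \<epsilon> + \<delta> * (\<kappa> * x)" using assms by (intro add_nonneg_nonneg[OF pos] mult_nonneg_nonneg) auto
  ultimately have "(1 + \<delta>) * x * (\<kappa> * x + \<epsilon> + \<delta> * (\<kappa> * x)) \<le> (1 + 2 * \<delta>) * x * ((1 + 2 * \<delta>) * (\<kappa> * x + \<epsilon>))"
    using assms pos by (intro mult_mono) (auto simp: algebra_simps)
  also have "\<dots> = ((1 + 2 * \<delta>) * p)\<^sup>2" using p2 by (simp add: power_mult_distrib power2_eq_square)
  finally have upper: "q \<le> ((1 + 2 * \<delta>) * p)\<^sup>2" using q by simp
  show "(sqrt q)\<^sup>2 = \<kappa> * ((1 + \<delta>) * x)\<^sup>2 + \<epsilon> * ((1 + \<delta>) * x)"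
    using order_trans[OF zero_le_power2 lower] by (simp add: q_def)
  show "p \<le> sqrt q" using lower by (rule real_le_rsqrt)
  show "sqrt q \<le> (1 + 2 * \<delta>) * p"
    using upper assms by (intro real_le_lsqrt) auto
qed

text \<open>
  The last three disjuncts say in which of the components \<open>u\<close>, \<open>v\<close>, \<open>w\<close> the phase difference
  is observed; the lower bound \<open>R\<close> is for the amplitude-dependent part of its frequency.
\<close>

definition resonant_triad :: "real \<Rightarrow> real \<Rightarrow> real \<Rightarrow> real \<Rightarrow> real \<Rightarrow> real \<Rightarrow> real \<Rightarrow> bool" where
  "resonant_triad \<alpha> \<beta> \<gamma> s K c R \<longleftrightarrow>
    (\<exists>k l m x g p \<epsilon>. k = l + m \<and> m > 0 \<and> x > 0 \<and> g > 0 \<and> p \<ge> 0 \<and> \<bar>\<epsilon>\<bar> \<le> x \<and>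
      of_int m * \<epsilon> = \<alpha> * (of_int k)\<^sup>2 - \<beta> * (of_int l)\<^sup>2 - \<gamma> * (of_int m)\<^sup>2 \<and>
      p\<^sup>2 = (g\<^sup>2 + 1 / g\<^sup>2) * x\<^sup>2 + \<epsilon> * x \<and>
      sobolev_weight s k * x + sobolev_weight s l * (p * g) + sobolev_weight s m * (p / g) \<le> K \<and>
      (c \<le> sobolev_weight s k * x \<and> R \<le> of_int m * (g\<^sup>2 + 1 / g\<^sup>2) * x \<or>
       c \<le> sobolev_weight s l * (p * g) \<and> R \<le> of_int m * x / g\<^sup>2 \<or>
       c \<le> sobolev_weight s m * (p / g) \<and> R \<le> of_int m * x * g\<^sup>2))"

lemma resonant_triadI:
  assumes "m > 0" "x > 0" "g > 0" "p \<ge> 0" "\<bar>\<epsilon>\<bar> \<le> x"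
    and "of_int m * \<epsilon> = \<alpha> * (of_int (l + m))\<^sup>2 - \<beta> * (of_int l)\<^sup>2 - \<gamma> * (of_int m)\<^sup>2"
    and "p\<^sup>2 = (g\<^sup>2 + 1 / g\<^sup>2) * x\<^sup>2 + \<epsilon> * x"
    and "sobolev_weight s (l + m) * x + sobolev_weight s l * (p * g) + sobolev_weight s m * (p / g) \<le> K"
    and "c \<le> sobolev_weight s (l + m) * x \<and> R \<le> of_int m * (g\<^sup>2 + 1 / g\<^sup>2) * x \<or>
       c \<le> sobolev_weight s l * (p * g) \<and> R \<le> of_int m * x / g\<^sup>2 \<or>
       c \<le> sobolev_weight s m * (p / g) \<and> R \<le> of_int m * x * g\<^sup>2"
  shows "resonant_triad \<alpha> \<beta> \<gamma> s K c R"
  unfolding resonant_triad_def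
  by (rule exI[of _ "l + m"], rule exI[of _ l], rule exI[of _ m], rule exI[of _ x], rule exI[of _ g],
      rule exI[of _ p], rule exI[of _ \<epsilon>]) (intro conjI refl assms)

lemma sobolev_weight_nonneg [simp]: "sobolev_weight s k \<ge> 0"
  by (simp add: sobolev_weight_def)

text \<open>Expanding the square of \<open>g - 1 / g\<close>; this supplies the bound on
  \<open>\<kappa>\<close> in \<open>amplitude_perturbation\<close>.\<close>

lemma sum_two_ge_one: "(g::real) > 0 \<Longrightarrow> g\<^sup>2 + 1 / g\<^sup>2 \<ge> 2"
  using zero_le_power2[of "g - 1 / g"] by (simp add: power2_diff power_divide)

text \<open>Replacing \<open>x\<close> by \<open>(1 + \<delta>) * x\<close> with \<open>g\<close>
  fixed changes each amplitude by a relative amount of at most \<open>2 * \<delta>\<close>, but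
  shifts the frequency of the observed component by \<open>\<delta> * \<sigma>\<close> with
  \<open>\<sigma> \<ge> R\<close>. At time \<open>pi / (\<delta> * \<sigma>)\<close> this component
  and its copy have opposite phases.\<close>

lemma resonant_triad_separation:
  fixes \<delta> :: real
  assumes "resonant_triad \<alpha> \<beta> \<gamma> s K c R" and "R > 0" "0 < \<delta>" "\<delta> \<le> 1"
  obtains u v w u' v' w' :: "real \<Rightarrow> real^'n \<Rightarrow> complex^'n" and t
  where "0 < t" "t \<le> pi / (\<delta> * R)"
    "classical_solution_up_to \<alpha> \<beta> \<gamma> t u v w" "classical_solution_up_to \<alpha> \<beta> \<gamma> t u' v' w'"
    "Hs_norm s (u 0) (v 0) (w 0) + Hs_norm s (u' 0) (v' 0) (w' 0) \<le> ereal (4 * K)"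
    "Hs_norm s (\<lambda>x. u 0 x - u' 0 x) (\<lambda>x. v 0 x - v' 0 x) (\<lambda>x. w 0 x - w' 0 x)
      \<le> ereal (2 * \<delta> * K)"
    "ereal c \<le> Hs_norm s (\<lambda>x. u t x - u' t x) (\<lambda>x. v t x - v' t x) (\<lambda>x. w t x - w' t x)"
proof -
  obtain k l m x g p \<epsilon> where k: "k = l + m" and m: "m > 0" and x: "x > 0" and g: "g > 0"
    and p: "p \<ge> 0" and \<epsilon>x: "\<bar>\<epsilon>\<bar> \<le> x"
    and \<epsilon>: "of_int m * \<epsilon> = \<alpha> * (of_int k)\<^sup>2 - \<beta> * (of_int l)\<^sup>2 - \<gamma> * (of_int m)\<^sup>2"
    and p2: "p\<^sup>2 = (g\<^sup>2 + 1 / g\<^sup>2) * x\<^sup>2 + \<epsilon> * x"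
    and K: "sobolev_weight s k * x + sobolev_weight s l * (p * g) + sobolev_weight s m * (p / g) \<le> K"
    and cases: "c \<le> sobolev_weight s k * x \<and> R \<le> of_int m * (g\<^sup>2 + 1 / g\<^sup>2) * x \<or>
       c \<le> sobolev_weight s l * (p * g) \<and> R \<le> of_int m * x / g\<^sup>2 \<or>
       c \<le> sobolev_weight s m * (p / g) \<and> R \<le> of_int m * x * g\<^sup>2"
    using assms(1) unfolding resonant_triad_def by blast
  let ?\<kappa> = "g\<^sup>2 + 1 / g\<^sup>2"
  define x' where "x' = (1 + \<delta>) * x"
  obtain p' where p'2: "p'\<^sup>2 = ?\<kappa> * x'\<^sup>2 + \<epsilon> * x'" and pp': "p \<le> p'" "p' \<le> (1 + 2 * \<delta>) * p"
    using amplitude_perturbation[OF x sum_two_ge_one[OF g] \<epsilon>x _ p p2, of \<delta>] assms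
    unfolding x'_def by auto
  have p': "p' \<ge> 0" using p pp' by simp
  have x': "x' > 0" using x assms by (simp add: x'_def)
  define A where "A = of_int m * (?\<kappa> * x + \<epsilon>) - \<alpha> * (of_int k)\<^sup>2"
  define B where "B = of_int m * x / g\<^sup>2 - \<beta> * (of_int l)\<^sup>2"
  define C where "C = of_int m * x * g\<^sup>2 - \<gamma> * (of_int m)\<^sup>2"
  define A' where "A' = of_int m * (?\<kappa> * x' + \<epsilon>) - \<alpha> * (of_int k)\<^sup>2"
  define B' where "B' = of_int m * x' / g\<^sup>2 - \<beta> * (of_int l)\<^sup>2"
  define C' where "C' = of_int m * x' * g\<^sup>2 - \<gamma> * (of_int m)\<^sup>2"
  \<comment> \<open>Here \<open>undefined\<close> is an arbitrary coordinate direction, the same one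
    for all six fields.\<close>
  define wave :: "complex \<Rightarrow> int \<Rightarrow> real \<Rightarrow> real \<Rightarrow> real \<Rightarrow> real^'n \<Rightarrow> complex^'n"
    where "wave \<zeta> q r \<omega> t = plane_wave undefined q (\<zeta> * of_real r * cis (\<omega> * t))" for \<zeta> q r \<omega> t
  define D where "D t = Hs_norm s (\<lambda>y. wave \<i> k x A t y - wave \<i> k x' A' t y)
      (\<lambda>y. wave 1 l (p * g) B t y - wave 1 l (p' * g) B' t y)
      (\<lambda>y. wave 1 m (p / g) C t y - wave 1 m (p' / g) C' t y)" for t
  have sol: "classical_solution_up_to \<alpha> \<beta> \<gamma> t (wave \<i> k x A) (wave 1 l (p * g) B) (wave 1 m (p / g) C)"
    for t
    using triad_solution[OF k x g p2 \<epsilon>, of t undefined] unfolding wave_def A_def B_def C_def by simp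
  have sol': "classical_solution_up_to \<alpha> \<beta> \<gamma> t (wave \<i> k x' A') (wave 1 l (p' * g) B') (wave 1 m (p' / g) C')"
    for t
    using triad_solution[OF k x' g p'2 \<epsilon>, of t undefined] unfolding wave_def A'_def B'_def C'_def by simp
  have xx': "0 \<le> x' - x" "x' - x \<le> 2 * \<delta> * x" using x assms by (simp_all add: x'_def algebra_simps)
  have pg: "0 \<le> p' * g - p * g" "p' * g - p * g \<le> 2 * \<delta> * (p * g)"
    and pg': "0 \<le> p' / g - p / g" "p' / g - p / g \<le> 2 * \<delta> * (p / g)"
    using mult_right_mono[OF pp'(1), of g] mult_right_mono[OF pp'(2), of g]
      divide_right_mono[OF pp'(1), of g] divide_right_mono[OF pp'(2), of g] g
    by (simp_all add: algebra_simps add_divide_distrib)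
  have D0: "sobolev_weight s k * (x' - x) + sobolev_weight s l * (p' * g - p * g)
      + sobolev_weight s m * (p' / g - p / g) \<le> 2 * \<delta> * K"
  proof -
    have "sobolev_weight s k * (x' - x) + sobolev_weight s l * (p' * g - p * g)
      + sobolev_weight s m * (p' / g - p / g)
      \<le> sobolev_weight s k * (2 * \<delta> * x) + sobolev_weight s l * (2 * \<delta> * (p * g))
      + sobolev_weight s m * (2 * \<delta> * (p / g))"
      by (intro add_mono mult_left_mono xx' pg pg') auto
    also have "\<dots> = 2 * \<delta> * (sobolev_weight s k * x + sobolev_weight s l * (p * g)
      + sobolev_weight s m * (p / g))" by (simp add: algebra_simps)
    also have "\<dots> \<le> 2 * \<delta> * K" using K assms by (intro mult_left_mono) auto
    finally show ?thesis .
  qed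
  have K0: "0 \<le> K"
    using K x p g by (intro order_trans[OF _ K] add_nonneg_nonneg mult_nonneg_nonneg) auto
  then have "2 * \<delta> * K \<le> 2 * K" using assms by (simp add: mult_left_le_one_le mult.assoc)
  \<comment> \<open>As \<open>\<delta> \<le> 1\<close>, the second datum exceeds the first by at
    most \<open>2 * K\<close>, so the two together stay below \<open>K + 3 * K\<close>.\<close>
  then have bound: "(sobolev_weight s k * x + sobolev_weight s l * (p * g) + sobolev_weight s m * (p / g))
      + (sobolev_weight s k * x' + sobolev_weight s l * (p' * g) + sobolev_weight s m * (p' / g)) \<le> 4 * K"
    using D0 K unfolding right_diff_distrib by linarith
  have norms: "Hs_norm s (wave \<i> k x A 0) (wave 1 l (p * g) B 0) (wave 1 m (p / g) C 0)
      + Hs_norm s (wave \<i> k x' A' 0) (wave 1 l (p' * g) B' 0) (wave 1 m (p' / g) C' 0) \<le> ereal (4 * K)"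
    using bound x x' p p' g by (simp add: wave_def Hs_norm_plane_wave norm_mult norm_divide)
  have DH: "D t = ereal (
      sobolev_weight s k * cmod (\<i> * of_real x * cis (A * t) - \<i> * of_real x' * cis (A' * t)) +
      sobolev_weight s l * cmod (1 * of_real (p * g) * cis (B * t) - 1 * of_real (p' * g) * cis (B' * t)) +
      sobolev_weight s m * cmod (1 * of_real (p / g) * cis (C * t) - 1 * of_real (p' / g) * cis (C' * t)))" for t
    unfolding D_def wave_def plane_wave_diff Hs_norm_plane_wave ..
  have summands: "a \<le> a + b + c" "b \<le> a + b + c" "c \<le> a + b + c"
    if "0 \<le> a" "0 \<le> b" "0 \<le> c" for a b c :: real
    using that by simp_all
  have ge:
    "ereal (sobolev_weight s k * cmod (\<i> * of_real x * cis (A * t) - \<i> * of_real x' * cis (A' * t))) \<le> D t"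
    "ereal (sobolev_weight s l * cmod (1 * of_real (p * g) * cis (B * t) - 1 * of_real (p' * g) * cis (B' * t))) \<le> D t"
    "ereal (sobolev_weight s m * cmod (1 * of_real (p / g) * cis (C * t) - 1 * of_real (p' / g) * cis (C' * t))) \<le> D t"
    for t
    unfolding DH ereal_less_eq by (rule summands; intro mult_nonneg_nonneg; simp)+
  have diff0: "D 0 \<le> ereal (2 * \<delta> * K)"
  proof -
    have "cmod (\<i> * of_real x - \<i> * of_real x') = x' - x"
      using xx' by (simp add: right_diff_distrib[symmetric] norm_mult of_real_diff[symmetric] del: of_real_diff)
    moreover have "cmod (of_real (p * g) - of_real (p' * g)) = p' * g - p * g"
      using pg by (simp add: of_real_diff[symmetric] del: of_real_diff of_real_mult)
    moreover have "cmod (of_real (p / g) - of_real (p' / g)) = p' / g - p / g"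
      using pg' by (simp add: of_real_diff[symmetric] del: of_real_diff of_real_divide)
    ultimately show ?thesis unfolding DH using D0 by simp
  qed
  have phase: "\<omega>' * (pi / (\<delta> * \<sigma>)) = \<omega> * (pi / (\<delta> * \<sigma>)) + pi"
    if "\<omega>' = \<omega> + \<delta> * \<sigma>" "R \<le> \<sigma>" for \<omega> \<omega>' \<sigma>
    using that assms by (simp add: distrib_right add_divide_distrib)
  \<comment> \<open>The time is adapted to the one observed component. The other two contribute
    nonnegative terms to the norm, so their phases need no control.\<close>
  have "\<exists>\<sigma>\<ge>R. ereal c \<le> D (pi / (\<delta> * \<sigma>))"
    using cases
  proof (elim disjE conjE)
    let ?\<sigma> = "of_int m * ?\<kappa> * x"
    assume c: "c \<le> sobolev_weight s k * x" and R: "R \<le> ?\<sigma>"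
    have "A' = A + \<delta> * ?\<sigma>" by (simp add: A_def A'_def x'_def algebra_simps add_divide_distrib)
    then have "A' * (pi / (\<delta> * ?\<sigma>)) = A * (pi / (\<delta> * ?\<sigma>)) + pi"
      using R by (rule phase)
    then have cm: "cmod (\<i> * of_real x * cis (A * (pi / (\<delta> * ?\<sigma>))) - \<i> * of_real x' * cis (A' * (pi / (\<delta> * ?\<sigma>))))
        = x + x'" using x x' by (intro cmod_opposite_phases) auto
    have le: "sobolev_weight s k * x \<le> sobolev_weight s k * (x + x')"
      using x' by (intro mult_left_mono) auto
    have "ereal c \<le> D (pi / (\<delta> * ?\<sigma>))"
      using order_trans[OF c le] by (intro order_trans[OF _ ge(1)[of "pi / (\<delta> * ?\<sigma>)", unfolded cm]]) simp
    then show ?thesis using R by blast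
  next
    let ?\<sigma> = "of_int m * x / g\<^sup>2"
    assume c: "c \<le> sobolev_weight s l * (p * g)" and R: "R \<le> ?\<sigma>"
    have "of_int m * x' / g\<^sup>2 = (1 + \<delta>) * ?\<sigma>"
      by (simp only: x'_def times_divide_eq_right mult_ac)
    then have "B' = B + \<delta> * ?\<sigma>" by (simp only: B_def B'_def distrib_right)
    then have "B' * (pi / (\<delta> * ?\<sigma>)) = B * (pi / (\<delta> * ?\<sigma>)) + pi"
      using R by (rule phase)
    then have cm: "cmod (1 * of_real (p * g) * cis (B * (pi / (\<delta> * ?\<sigma>))) - 1 * of_real (p' * g) * cis (B' * (pi / (\<delta> * ?\<sigma>))))
        = p * g + p' * g" using p p' g by (intro cmod_opposite_phases) auto
    have le: "sobolev_weight s l * (p * g) \<le> sobolev_weight s l * (p * g + p' * g)"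
      using p' g by (intro mult_left_mono) auto
    have "ereal c \<le> D (pi / (\<delta> * ?\<sigma>))"
      using order_trans[OF c le] by (intro order_trans[OF _ ge(2)[of "pi / (\<delta> * ?\<sigma>)", unfolded cm]]) simp
    then show ?thesis using R by blast
  next
    let ?\<sigma> = "of_int m * x * g\<^sup>2"
    assume c: "c \<le> sobolev_weight s m * (p / g)" and R: "R \<le> ?\<sigma>"
    have "C' = C + \<delta> * ?\<sigma>" by (simp add: C_def C'_def x'_def algebra_simps)
    then have "C' * (pi / (\<delta> * ?\<sigma>)) = C * (pi / (\<delta> * ?\<sigma>)) + pi"
      using R by (rule phase)
    then have cm: "cmod (1 * of_real (p / g) * cis (C * (pi / (\<delta> * ?\<sigma>))) - 1 * of_real (p' / g) * cis (C' * (pi / (\<delta> * ?\<sigma>))))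
        = p / g + p' / g" using p p' g by (intro cmod_opposite_phases) auto
    have le: "sobolev_weight s m * (p / g) \<le> sobolev_weight s m * (p / g + p' / g)"
      using p' g by (intro mult_left_mono) auto
    have "ereal c \<le> D (pi / (\<delta> * ?\<sigma>))"
      using order_trans[OF c le] by (intro order_trans[OF _ ge(3)[of "pi / (\<delta> * ?\<sigma>)", unfolded cm]]) simp
    then show ?thesis using R by blast
  qed
  then obtain \<sigma> where \<sigma>: "R \<le> \<sigma>" "ereal c \<le> D (pi / (\<delta> * \<sigma>))" by blast
  have "0 < pi / (\<delta> * \<sigma>)" "pi / (\<delta> * \<sigma>) \<le> pi / (\<delta> * R)"
    using \<sigma> assms by (auto intro!: divide_left_mono mult_left_mono)
  then show thesis
    by (rule that[OF _ _ sol sol' norms diff0[unfolded D_def] \<sigma>(2)[unfolded D_def]])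
qed

text \<open>Uniformity of \<open>K\<close> and \<open>c\<close> in \<open>R\<close> is what allows
  the relative perturbation to tend to zero while \<open>R\<close> grows fast enough for the
  separation times to tend to zero as well.\<close>

lemma failure_from_resonant_triads:
  fixes \<alpha> \<beta> \<gamma> s :: real
  assumes "c > 0" and triads: "\<And>R. resonant_triad \<alpha> \<beta> \<gamma> s K c R"
  shows "\<exists>(u :: nat \<Rightarrow> real \<Rightarrow> real^'n \<Rightarrow> complex^'n) v w u' v' w' (t :: nat \<Rightarrow> real) (C :: real) (c :: real).
    C > 0 \<and> c > 0 \<and>
    (\<forall>n. t n > 0) \<and>
    (\<forall>n. classical_solution_up_to \<alpha> \<beta> \<gamma> (t n) (u n) (v n) (w n)) \<and>
    (\<forall>n. classical_solution_up_to \<alpha> \<beta> \<gamma> (t n) (u' n) (v' n) (w' n)) \<and>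
    t \<longlonglongrightarrow> 0 \<and>
    (SUP n. Hs_norm s (u n 0) (v n 0) (w n 0) + Hs_norm s (u' n 0) (v' n 0) (w' n 0)) \<le> ereal C \<and>
    (\<lambda>n. Hs_norm s (\<lambda>x. u n 0 x - u' n 0 x) (\<lambda>x. v n 0 x - v' n 0 x) (\<lambda>x. w n 0 x - w' n 0 x))
      \<longlonglongrightarrow> 0 \<and>
    (\<exists>L. (\<lambda>n. Hs_norm s (\<lambda>x. u n (t n) x - u' n (t n) x) (\<lambda>x. v n (t n) x - v' n (t n) x)
              (\<lambda>x. w n (t n) x - w' n (t n) x)) \<longlonglongrightarrow> L \<and> L \<ge> ereal c)"
proof -
  define d :: "nat \<Rightarrow> real" where "d n = inverse (real (Suc n))" for n
  have d: "d \<longlonglongrightarrow> 0" "0 < d n" "d n \<le> 1" for n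
    using LIMSEQ_inverse_real_of_nat by (simp_all add: d_def[abs_def] inverse_le_1_iff)
  let ?diff = "\<lambda>u v w u' v' w' t. Hs_norm s (\<lambda>x::real^'n. u t x - u' t x)
    (\<lambda>x. v t x - v' t x) (\<lambda>x. w t x - w' t x)"
  let ?P = "\<lambda>n (u :: real \<Rightarrow> real^'n \<Rightarrow> complex^'n) v w u' v' w' (t::real). 0 < t \<and> t \<le> pi * d n \<and>
    classical_solution_up_to \<alpha> \<beta> \<gamma> t u v w \<and> classical_solution_up_to \<alpha> \<beta> \<gamma> t u' v' w' \<and>
    Hs_norm s (u 0) (v 0) (w 0) + Hs_norm s (u' 0) (v' 0) (w' 0) \<le> ereal (4 * K) \<and>
    ?diff u v w u' v' w' 0 \<le> ereal (2 * d n * K) \<and>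
    ereal c \<le> ?diff u v w u' v' w' t"
  have "\<forall>n. \<exists>u v w u' v' w' t. ?P n u v w u' v' w' t"
  proof
    fix n
    \<comment> \<open>With perturbation \<open>d n\<close> and \<open>R = 1 / (d n)\<^sup>2\<close>,
      the separation time is at most \<open>pi * d n\<close>.\<close>
    have "pi / (d n * (1 / (d n)\<^sup>2)) = pi * d n"
      using d(2)[of n] by (simp add: power2_eq_square)
    note eq = this
    have pos: "1 / (d n)\<^sup>2 > 0" using d(2)[of n] by simp
    obtain u v w u' v' w' :: "real \<Rightarrow> real^'n \<Rightarrow> complex^'n" and t
      where "0 < t" "t \<le> pi / (d n * (1 / (d n)\<^sup>2))"
        "classical_solution_up_to \<alpha> \<beta> \<gamma> t u v w" "classical_solution_up_to \<alpha> \<beta> \<gamma> t u' v' w'"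
        "Hs_norm s (u 0) (v 0) (w 0) + Hs_norm s (u' 0) (v' 0) (w' 0) \<le> ereal (4 * K)"
        "?diff u v w u' v' w' 0 \<le> ereal (2 * d n * K)"
        "ereal c \<le> ?diff u v w u' v' w' t"
      by (rule resonant_triad_separation[OF triads pos d(2)[of n] d(3)[of n]])
    then have "?P n u v w u' v' w' t" unfolding eq by (intro conjI)
    then show "\<exists>u v w u' v' w' t. ?P n u v w u' v' w' t"
      by (intro exI[of _ u] exI[of _ v] exI[of _ w] exI[of _ u'] exI[of _ v'] exI[of _ w'] exI[of _ t])
  qed
  then obtain u v w u' v' w' t where "\<forall>n. ?P n (u n) (v n) (w n) (u' n) (v' n) (w' n) (t n)"
    unfolding choice_iff by (elim exE) (rule that)
  then have P: "?P n (u n) (v n) (w n) (u' n) (v' n) (w' n) (t n)" for n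
    by (rule spec)
  have t: "0 < t n" "t n \<le> pi * d n"
    and sol: "classical_solution_up_to \<alpha> \<beta> \<gamma> (t n) (u n) (v n) (w n)"
      "classical_solution_up_to \<alpha> \<beta> \<gamma> (t n) (u' n) (v' n) (w' n)"
    and initial: "Hs_norm s (u n 0) (v n 0) (w n 0) + Hs_norm s (u' n 0) (v' n 0) (w' n 0) \<le> ereal (4 * K)"
      "?diff (u n) (v n) (w n) (u' n) (v' n) (w' n) 0 \<le> ereal (2 * d n * K)"
    and final: "ereal c \<le> ?diff (u n) (v n) (w n) (u' n) (v' n) (w' n) (t n)" for n
    using P[of n] by blast+
  have nonneg: "0 \<le> Hs_norm s f g h" for f g h :: "real^'n \<Rightarrow> complex^'n"
    by (auto simp: Hs_norm_def sobolev_norm_vec_def sobolev_norm_def sobolev_term_def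
        intro!: add_nonneg_nonneg sum_nonneg infsum_nonneg)
  define D0 where "D0 n = ?diff (u n) (v n) (w n) (u' n) (v' n) (w' n) 0" for n
  define Dt where "Dt n = ?diff (u n) (v n) (w n) (u' n) (v' n) (w' n) (t n)" for n
  have t0: "t \<longlonglongrightarrow> 0"
  proof (rule tendsto_sandwich[where f="\<lambda>_. 0"])
    show "(\<lambda>n. pi * d n) \<longlonglongrightarrow> 0" using tendsto_mult_right[OF d(1), of pi] by simp
  qed (auto intro!: always_eventually less_imp_le t)
  have D0: "D0 \<longlonglongrightarrow> 0"
  proof (rule tendsto_sandwich[where f="\<lambda>_. 0"])
    have "(\<lambda>n. 2 * d n * K) \<longlonglongrightarrow> 0"
      using tendsto_mult_right[OF d(1), of "2 * K"] by (simp add: mult_ac)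
    then show "(\<lambda>n. ereal (2 * d n * K)) \<longlonglongrightarrow> 0" by (simp add: zero_ereal_def)
  qed (auto simp: D0_def intro!: always_eventually nonneg initial)
  \<comment> \<open>The final distances are only bounded below. Compactness of the extended reals
    yields a subsequence with a limit, possibly infinite, and everything is restricted to
    it.\<close>
  obtain L r where r: "strict_mono r" and L: "(Dt \<circ> r) \<longlonglongrightarrow> L"
    using compact_complete_linorder[of Dt] by blast
  have cL: "ereal c \<le> L"
    by (intro LIMSEQ_le_const[OF L]) (auto simp: Dt_def final)
  have bounded: "(SUP n. Hs_norm s (u (r n) 0) (v (r n) 0) (w (r n) 0)
      + Hs_norm s (u' (r n) 0) (v' (r n) 0) (w' (r n) 0)) \<le> ereal (max 1 (4 * K))"
    \<comment> \<open>The maximum with 1 makes the constant positive without any assumption on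
      \<open>K\<close>.\<close>
    by (intro SUP_least order_trans[OF initial(1)]) simp
  have lim_t: "(\<lambda>n. t (r n)) \<longlonglongrightarrow> 0"
    using LIMSEQ_subseq_LIMSEQ[OF t0 r] by (simp only: o_def)
  have lim_0: "(\<lambda>n. ?diff (u (r n)) (v (r n)) (w (r n)) (u' (r n)) (v' (r n)) (w' (r n)) 0) \<longlonglongrightarrow> 0"
    using LIMSEQ_subseq_LIMSEQ[OF D0 r] by (simp only: o_def D0_def)
  have lim_L: "(\<lambda>n. ?diff (u (r n)) (v (r n)) (w (r n)) (u' (r n)) (v' (r n)) (w' (r n)) (t (r n))) \<longlonglongrightarrow> L"
    using L by (simp only: o_def Dt_def)
  have C: "max 1 (4 * K) > 0" by simp
  show ?thesis
    by (intro exI[of _ "\<lambda>n. u (r n)"] exI[of _ "\<lambda>n. v (r n)"] exI[of _ "\<lambda>n. w (r n)"]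
        exI[of _ "\<lambda>n. u' (r n)"] exI[of _ "\<lambda>n. v' (r n)"] exI[of _ "\<lambda>n. w' (r n)"]
        exI[of _ "\<lambda>n. t (r n)"] exI[of _ "max 1 (4 * K)"] exI[of _ c] exI[of _ L]
        conjI allI C \<open>c > 0\<close> t(1) sol lim_t bounded lim_0 lim_L cL)
qed

section \<open>Existence of resonant triads\<close>

lemma sobolev_weight_pos: "sobolev_weight s k > 0"
proof -
  have "0 < 1 + (real_of_int k)\<^sup>2" by (simp add: add_pos_nonneg)
  then show ?thesis unfolding sobolev_weight_def by simp
qed

lemma sobolev_weight_0 [simp]: "sobolev_weight s 0 = 1"
  by (simp add: sobolev_weight_def)

lemma sobolev_weight_minus: "sobolev_weight s (- k) = sobolev_weight s k"
  by (simp add: sobolev_weight_def)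

lemma sobolev_weight_ge_1: "s \<ge> 0 \<Longrightarrow> sobolev_weight s k \<ge> 1"
  by (simp add: sobolev_weight_def ge_one_powr_ge_zero)

lemma sobolev_weight_le_1: "s \<le> 0 \<Longrightarrow> sobolev_weight s k \<le> 1"
  using powr_mono[of "s / 2" 0 "1 + (real_of_int k)\<^sup>2"]
  by (simp add: sobolev_weight_def split: if_splits)

section \<open>Exactly resonant triads with one field constant in space\<close>

lemma sqrt_2_bounds: "1 \<le> sqrt 2" "sqrt 2 \<le> 2"
  by (auto intro: real_le_lsqrt)

lemma int_ge_real:
  fixes R :: real
  obtains m :: int where "m > 0" "R \<le> of_int m"
  by (rule that[of "max 1 \<lceil>R\<rceil>"]) (simp_all add: of_int_max le_max_iff_disj)

lemma two_divide_int_le: "m > 0 \<Longrightarrow> 2 / real_of_int m \<le> 2"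
  using divide_left_mono[of 1 "real_of_int m" 2] by simp

text \<open>For \<open>l = 0\<close> the resonance is exact. As \<open>v\<close> has weight 1, it
  may carry an amplitude of order 1, while \<open>u\<close> and \<open>w\<close> have amplitudes of
  order \<open>1 / G\<close>. The choice \<open>g = sqrt G\<close> then gives \<open>w\<close> the
  nonlinear frequency \<open>m\<close>, whatever the size of \<open>s\<close>.\<close>

lemma resonant_triad_const_v_pos:
  assumes "s \<ge> 0"
  shows "resonant_triad \<alpha> \<beta> \<alpha> s 5 1 R"
proof -
  obtain m :: int where m: "m > 0" "R \<le> of_int m" by (rule int_ge_real)
  define G where "G = sobolev_weight s m"
  have G: "G \<ge> 1" using sobolev_weight_ge_1[OF assms] by (simp add: G_def)
  \<comment> \<open>The ansatz \<open>p = q / sqrt G\<close> turns the condition on \<open>p\<close>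
    into \<open>q\<^sup>2 = 1 + 1 / G\<^sup>2\<close>.\<close>
  define q where "q = sqrt (1 + 1 / G\<^sup>2)"
  have q2: "q\<^sup>2 = 1 + 1 / G\<^sup>2" by (simp add: q_def)
  have "1 / G\<^sup>2 \<le> 1" using G by simp
  then have q: "1 \<le> q" "q \<le> 2" unfolding q_def by (auto intro!: real_le_lsqrt)
  have g2: "(sqrt G)\<^sup>2 = G" using G by simp
  show ?thesis
  proof (rule resonant_triadI[where l = 0 and m = m and x = "1 / G" and g = "sqrt G" and p = "q / sqrt G" and \<epsilon> = 0])
    show "m > 0" by fact
    show "1 / G > 0" "sqrt G > 0" "q / sqrt G \<ge> 0" "\<bar>0\<bar> \<le> 1 / G" using G q by auto
    show "of_int m * 0 = \<alpha> * (of_int (0 + m))\<^sup>2 - \<beta> * (of_int 0)\<^sup>2 - \<alpha> * (of_int m)\<^sup>2" by simp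
    show "(q / sqrt G)\<^sup>2 = ((sqrt G)\<^sup>2 + 1 / (sqrt G)\<^sup>2) * (1 / G)\<^sup>2 + 0 * (1 / G)"
      using G unfolding power_divide g2 q2 by (simp add: field_simps power2_eq_square)
    have qG: "q / sqrt G * sqrt G = q" "q / sqrt G / sqrt G = q / G"
      using G g2 by (auto simp: power2_eq_square)
    show "sobolev_weight s (0 + m) * (1 / G) + sobolev_weight s 0 * (q / sqrt G * sqrt G)
        + sobolev_weight s m * (q / sqrt G / sqrt G) \<le> 5"
      unfolding qG using G q by (simp add: G_def[symmetric])
    have "1 \<le> sobolev_weight s m * (q / sqrt G / sqrt G) \<and> R \<le> of_int m * (1 / G) * (sqrt G)\<^sup>2"
      unfolding qG g2 using G q m by (simp add: G_def[symmetric])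
    then show "1 \<le> sobolev_weight s (0 + m) * (1 / G) \<and> R \<le> of_int m * ((sqrt G)\<^sup>2 + 1 / (sqrt G)\<^sup>2) * (1 / G) \<or>
       1 \<le> sobolev_weight s 0 * (q / sqrt G * sqrt G) \<and> R \<le> of_int m * (1 / G) / (sqrt G)\<^sup>2 \<or>
       1 \<le> sobolev_weight s m * (q / sqrt G / sqrt G) \<and> R \<le> of_int m * (1 / G) * (sqrt G)\<^sup>2"
      by blast
  qed
qed

text \<open>Weights are at most 1, so amplitudes of order 1 are admissible at every frequency. The
  phase is observed in \<open>v\<close>, whose weight at frequency zero is exactly 1.\<close>

lemma resonant_triad_const_v_neg:
  assumes "s \<le> 0"
  shows "resonant_triad \<alpha> \<beta> \<alpha> s 5 1 R"
proof -
  obtain m :: int where m: "m > 0" "R \<le> of_int m" by (rule int_ge_real)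
  have w: "sobolev_weight s m \<le> 1" by (rule sobolev_weight_le_1) fact
  then have "sobolev_weight s m * sqrt 2 \<le> 1 * 2"
    using sqrt_2_bounds by (intro mult_mono) auto
  then show ?thesis
    using m w sqrt_2_bounds
    by (intro resonant_triadI[where l = 0 and m = m and x = 1 and g = 1 and p = "sqrt 2" and \<epsilon> = 0]) simp_all
qed

text \<open>With \<open>l = - m\<close> the field \<open>u\<close> has frequency zero and the defect
  \<open>- (\<beta> + \<gamma>) * m\<^sup>2\<close> vanishes. The phase is observed in
  \<open>u\<close>, again at weight 1.\<close>

lemma resonant_triad_const_u:
  assumes "s \<le> 0"
  shows "resonant_triad \<alpha> (- \<gamma>) \<gamma> s 5 1 R"
proof -
  obtain m :: int where m: "m > 0" "R \<le> of_int m" by (rule int_ge_real)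
  have w: "sobolev_weight s m \<le> 1" by (rule sobolev_weight_le_1) fact
  then have "sobolev_weight s m * sqrt 2 \<le> 1 * 2"
    using sqrt_2_bounds by (intro mult_mono) auto
  then show ?thesis
    using m w
    by (intro resonant_triadI[where l = "- m" and m = m and x = 1 and g = 1 and p = "sqrt 2" and \<epsilon> = 0])
      (simp_all add: sobolev_weight_minus)
qed

section \<open>Rational approximation and comparison of the weights\<close>

lemma Dirichlet_approx_large:
  fixes r :: real and N :: nat
  obtains l m :: int where "m > 0" "int N \<le> m" "\<bar>of_int l - r * of_int m\<bar> \<le> 2 / of_int m"
proof -
  define M where "M = max N 1"
  have M: "M \<ge> 1" "N \<le> M" by (auto simp: M_def)
  \<comment> \<open>Dirichlet's theorem alone may return a small denominator, for instance for
    rational \<open>r\<close>. The bound \<open>M\<^sup>2\<close> leaves room to multiply such a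
    denominator by up to \<open>M\<close>.\<close>
  obtain h k :: int where k: "0 < k" "k \<le> int (M\<^sup>2)" and h: "\<bar>of_int k * r - of_int h\<bar> < 1 / real (M\<^sup>2)"
  proof (rule Dirichlet_approx)
    show "0 < M\<^sup>2" using M by simp
  qed
  show thesis
  proof (cases "k \<ge> int M")
    case True
    have "real_of_int k \<le> real (M\<^sup>2)"
      using of_int_le_iff[THEN iffD2, OF k(2)] by (simp only: of_int_of_nat_eq)
    then have "1 / real (M\<^sup>2) \<le> 2 / of_int k"
      using k(1) by (intro frac_le) simp_all
    then show thesis using that[of k h] True M k h by (simp add: abs_minus_commute mult.commute)
  next
    case False
    \<comment> \<open>This is \<open>M / k\<close> rounded up, so \<open>j * k\<close> lies between
      \<open>M\<close> and \<open>2 * M\<close>.\<close>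
    define j where "j = (int M + k - 1) div k"
    have "int M + k - 1 = j * k + (int M + k - 1) mod k" by (simp add: j_def)
    moreover have "(int M + k - 1) mod k < k" "0 \<le> (int M + k - 1) mod k" using k by simp_all
    ultimately have j1: "int M \<le> j * k" and jk: "j * k \<le> int M + k - 1" by linarith+
    have j2: "j * k \<le> 2 * int M" using jk False by linarith
    have j3: "0 < j" using j1 M k by (smt (verit) mult_nonpos_nonneg of_nat_1 of_nat_mono)
    have j4: "j \<le> int M"
    proof (rule ccontr)
      assume "\<not> j \<le> int M"
      then have "int M + 1 \<le> j" by simp
      then have "(int M + 1) * k \<le> j * k" using k by (intro mult_right_mono) auto
      also note jk
      finally have "int M * k \<le> int M - 1" by (simp add: algebra_simps)
      moreover have "int M * 1 \<le> int M * k" using k by (intro mult_left_mono) auto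
      ultimately show False by simp
    qed
    have j5: "real_of_int j \<le> real M"
      using of_int_le_iff[THEN iffD2, OF j4] by (simp only: of_int_of_nat_eq)
    \<comment> \<open>Multiplying the fraction by \<open>j\<close> multiplies the error by
      \<open>j \<le> M\<close>, hence to at most \<open>1 / M\<close>; with
      \<open>j * k \<le> 2 * M\<close> this is where the constant 2 comes from.\<close>
    have "\<bar>of_int (j * h) - r * of_int (j * k)\<bar> = of_int j * \<bar>of_int k * r - of_int h\<bar>"
    proof -
      have "of_int (j * h) - r * of_int (j * k) = - of_int j * (of_int k * r - of_int h)"
        by (simp add: algebra_simps)
      then show ?thesis using j3 by (simp only: abs_mult)
    qed
    also have "\<dots> \<le> real M * (1 / real (M\<^sup>2))"
      using h j3 j5 by (intro mult_mono) simp_all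
    also have "\<dots> = 2 / (2 * real M)" using M by (simp add: power2_eq_square)
    also have "\<dots> \<le> 2 / of_int (j * k)"
    proof (rule divide_left_mono)
      have "real_of_int (j * k) \<le> of_int (2 * int M)" using j2 by (simp only: of_int_le_iff)
      then show "real_of_int (j * k) \<le> 2 * real M" by simp
      show "0 < 2 * real M * of_int (j * k)" using j3 k M by simp
    qed simp
    finally show thesis using that[of "j * k" "j * h"] j1 j3 k M by simp
  qed
qed

text \<open>For \<open>s \<ge> 0\<close> it suffices that \<open>l\<close> is at most of order
  \<open>m\<close>. For negative \<open>s\<close> a lower bound of order \<open>m\<close> is needed,
  which requires a nonzero slope \<open>\<rho>\<close> and large \<open>m\<close>.\<close>

lemma sobolev_weight_comparable:
  fixes s \<rho> :: real
  assumes "s \<ge> 0 \<or> \<rho> \<noteq> 0"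
  obtains K M :: real where "K \<ge> 0" "\<forall>l m. m > 0 \<longrightarrow> M \<le> of_int m \<longrightarrow>
    \<bar>of_int l - \<rho> * of_int m\<bar> \<le> 2 / of_int m \<longrightarrow> sobolev_weight s l \<le> K * sobolev_weight s m"
proof (cases "s \<ge> 0")
  case True
  show thesis
  \<comment> \<open>The error of \<open>l\<close> against \<open>\<rho> * m\<close> is at most 2, so
    its doubled square is at most 8, and \<open>1 + 8 = 9\<close>.\<close>
  proof (rule that[of "(9 + 2 * \<rho>\<^sup>2) powr (s / 2)" 0]; (intro allI impI)?)
    fix l m :: int assume m: "m > 0" and l: "\<bar>of_int l - \<rho> * of_int m\<bar> \<le> 2 / of_int m"
    let ?e = "of_int l - \<rho> * of_int m"
    have "2 / real_of_int m \<le> 2" using m by (intro two_divide_int_le) simp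
    then have "\<bar>?e\<bar> \<le> 2" using l by linarith
    then have "?e\<^sup>2 \<le> 2\<^sup>2" by (rule abs_le_square_iff[THEN iffD1, OF order_trans]) simp
    moreover have "(of_int l)\<^sup>2 \<le> 2 * (\<rho> * of_int m)\<^sup>2 + 2 * ?e\<^sup>2"
      using zero_le_power2[of "\<rho> * of_int m - ?e"] by (simp add: power2_eq_square algebra_simps)
    ultimately have "1 + (real_of_int l)\<^sup>2 \<le> 9 + 2 * (\<rho> * of_int m)\<^sup>2" by simp
    also have "\<dots> \<le> (9 + 2 * \<rho>\<^sup>2) * (1 + (of_int m)\<^sup>2)"
      by (simp add: algebra_simps power_mult_distrib)
    finally have "(1 + (real_of_int l)\<^sup>2) powr (s / 2) \<le> ((9 + 2 * \<rho>\<^sup>2) * (1 + (of_int m)\<^sup>2)) powr (s / 2)"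
      using True by (intro powr_mono2) auto
    then show "sobolev_weight s l \<le> (9 + 2 * \<rho>\<^sup>2) powr (s / 2) * sobolev_weight s m"
      by (simp add: sobolev_weight_def powr_mult)
  qed simp
next
  case False
  with assms have \<rho>: "\<rho> \<noteq> 0" and s: "s < 0" by auto
  show thesis
  \<comment> \<open>Beyond \<open>4 / |\<rho>|\<close> the number \<open>|\<rho> * m|\<close> is at
    least 4, twice the maximal error, hence at most \<open>2 * |l|\<close>.\<close>
  proof (rule that[of "(1 + 4 / \<rho>\<^sup>2) powr (- s / 2)" "4 / \<bar>\<rho>\<bar>"]; (intro allI impI)?)
    fix l m :: int assume m: "m > 0" "4 / \<bar>\<rho>\<bar> \<le> of_int m"
      and l: "\<bar>of_int l - \<rho> * of_int m\<bar> \<le> 2 / of_int m"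
    have "4 \<le> \<bar>\<rho>\<bar> * of_int m" using m \<rho> by (simp add: field_simps)
    moreover have "2 / real_of_int m \<le> 2" using m by (intro two_divide_int_le) simp
    moreover have "\<bar>\<rho> * of_int m\<bar> = \<bar>\<rho>\<bar> * of_int m" using m by (simp add: abs_mult)
    ultimately have "\<bar>\<rho> * of_int m\<bar> \<le> \<bar>2 * of_int l\<bar>" using l by linarith
    then have "(\<rho> * of_int m)\<^sup>2 \<le> (2 * of_int l)\<^sup>2" by (rule abs_le_square_iff[THEN iffD1])
    then have "(real_of_int m)\<^sup>2 \<le> 4 / \<rho>\<^sup>2 * (of_int l)\<^sup>2" using \<rho> by (simp add: field_simps)
    moreover have "1 + a \<le> (1 + c) * (1 + b)" if "a \<le> c * b" "0 \<le> c" "0 \<le> b" for a b c :: real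
      using that by (simp add: algebra_simps)
    ultimately have "1 + (real_of_int m)\<^sup>2 \<le> (1 + 4 / \<rho>\<^sup>2) * (1 + (of_int l)\<^sup>2)" by simp
    moreover have pos: "1 + (real_of_int m)\<^sup>2 > 0" "1 + (real_of_int l)\<^sup>2 > 0" "1 + 4 / \<rho>\<^sup>2 > 0"
      by (simp_all add: add_pos_nonneg)
    ultimately have "((1 + 4 / \<rho>\<^sup>2) * (1 + (of_int l)\<^sup>2)) powr (s / 2) \<le> (1 + (real_of_int m)\<^sup>2) powr (s / 2)"
      using s by (intro powr_mono2') auto
    then have "(1 + 4 / \<rho>\<^sup>2) powr (s / 2) * sobolev_weight s l \<le> sobolev_weight s m"
      using pos by (simp add: sobolev_weight_def powr_mult)
    then have "(1 + 4 / \<rho>\<^sup>2) powr (- s / 2) * ((1 + 4 / \<rho>\<^sup>2) powr (s / 2) * sobolev_weight s l)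
        \<le> (1 + 4 / \<rho>\<^sup>2) powr (- s / 2) * sobolev_weight s m"
      by (intro mult_left_mono) auto
    moreover have "(1 + 4 / \<rho>\<^sup>2) powr (- s / 2) * (1 + 4 / \<rho>\<^sup>2) powr (s / 2) = 1"
      using pos by (simp add: powr_add[symmetric])
    ultimately show "sobolev_weight s l \<le> (1 + 4 / \<rho>\<^sup>2) powr (- s / 2) * sobolev_weight s m"
      by (simp add: mult.assoc[symmetric])
  qed simp
qed

text \<open>The quotient grows like the power \<open>1 - s\<close> of \<open>m\<close>; it is the
  nonlinear frequency belonging to the amplitude \<open>1 / sobolev_weight s m\<close>.\<close>

lemma rate_unbounded:
  assumes "s < 1"
  obtains M :: real where "\<forall>m>0. M \<le> of_int m \<longrightarrow> Z \<le> of_int m / sobolev_weight s m"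
proof -
  have "filterlim (\<lambda>y::real. y powr ((1 - s) / 2)) at_top at_top"
    using assms by (intro real_powr_at_top) auto
  \<comment> \<open>Applied below to \<open>y = 1 + m\<^sup>2\<close>; the factor 2 pays for
    bounding \<open>sqrt y\<close> by \<open>2 * m\<close>.\<close>
  then have "eventually (\<lambda>y::real. 2 * \<bar>Z\<bar> \<le> y powr ((1 - s) / 2)) at_top"
    by (simp add: filterlim_at_top)
  then obtain M where M: "\<And>y. y \<ge> M \<Longrightarrow> 2 * \<bar>Z\<bar> \<le> y powr ((1 - s) / 2)"
    by (auto simp: eventually_at_top_linorder)
  show thesis
  proof (rule that[of M]; intro allI impI)
    fix m :: int assume m: "m > 0" "M \<le> of_int m"
    let ?T = "1 + (real_of_int m)\<^sup>2"
    have m1: "1 \<le> real_of_int m" using m by simp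
    then have "real_of_int m * 1 \<le> (of_int m)\<^sup>2" unfolding power2_eq_square by (intro mult_left_mono) auto
    then have "M \<le> ?T" using m by linarith
    then have "2 * \<bar>Z\<bar> \<le> ?T powr ((1 - s) / 2)" by (rule M)
    also have "\<dots> = ?T powr (1 / 2) / ?T powr (s / 2)"
      by (simp add: powr_diff[symmetric] diff_divide_distrib)
    also have "\<dots> \<le> 2 * of_int m / ?T powr (s / 2)"
    proof (rule divide_right_mono)
      have "?T powr (1 / 2) = sqrt ?T" by (simp add: powr_half_sqrt)
      also have "\<dots> \<le> 2 * of_int m"
      proof (rule real_le_lsqrt)
        have "(2 * real_of_int m)\<^sup>2 = 4 * (of_int m)\<^sup>2" by (simp add: power_mult_distrib)
        then show "?T \<le> (2 * of_int m)\<^sup>2" using one_le_power[OF m1, of 2] by linarith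
      qed (use m1 in simp)
      finally show "?T powr (1 / 2) \<le> 2 * of_int m" .
    qed simp
    finally show "Z \<le> of_int m / sobolev_weight s m" by (simp add: sobolev_weight_def)
  qed
qed

text \<open>
  Along the line \<open>l = r * m\<close> on which the resonance function vanishes, good rational approximations
  of \<open>r\<close> make the resonance defect bounded, which is negligible against the nonlinear
  frequency \<open>m\<^bsup>1 - s\<^esup>\<close>.
\<close>

lemma resonant_triad_root:
  assumes "s < 1" and root: "(\<alpha> - \<beta>) * r\<^sup>2 + 2 * \<alpha> * r + (\<alpha> - \<gamma>) = 0"
    and "s \<ge> 0 \<or> r \<noteq> 0 \<and> r \<noteq> - 1"
  obtains K where "\<And>R. resonant_triad \<alpha> \<beta> \<gamma> s K 1 R"
proof -
  \<comment> \<open>The frequency \<open>l + m\<close> of \<open>u\<close> approximates the slope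
    \<open>r + 1\<close> with the same error with which \<open>l\<close> approximates
    \<open>r\<close>.\<close>
  obtain K\<^sub>1 M\<^sub>1 :: real where K1: "K\<^sub>1 \<ge> 0" "\<forall>l m. m > 0 \<longrightarrow> M\<^sub>1 \<le> of_int m \<longrightarrow>
      \<bar>of_int l - (r + 1) * of_int m\<bar> \<le> 2 / of_int m \<longrightarrow> sobolev_weight s l \<le> K\<^sub>1 * sobolev_weight s m"
  proof (rule sobolev_weight_comparable)
    show "0 \<le> s \<or> r + 1 \<noteq> 0" using assms by auto
  qed
  obtain K\<^sub>2 M\<^sub>2 :: real where K2: "K\<^sub>2 \<ge> 0" "\<forall>l m. m > 0 \<longrightarrow> M\<^sub>2 \<le> of_int m \<longrightarrow>
      \<bar>of_int l - r * of_int m\<bar> \<le> 2 / of_int m \<longrightarrow> sobolev_weight s l \<le> K\<^sub>2 * sobolev_weight s m"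
  proof (rule sobolev_weight_comparable)
    show "0 \<le> s \<or> r \<noteq> 0" using assms by auto
  qed
  \<comment> \<open>A bound for \<open>|m * \<epsilon>|\<close>: the coefficients are those of
    \<open>e * m\<close> and \<open>e * e\<close> in the expansion below, where
    \<open>|e * m| \<le> 2\<close> and \<open>|e * e| \<le> 4\<close>.\<close>
  define E where "E = 2 * \<bar>2 * ((\<alpha> - \<beta>) * r + \<alpha>)\<bar> + 4 * \<bar>\<alpha> - \<beta>\<bar>"
  have "resonant_triad \<alpha> \<beta> \<gamma> s (K\<^sub>1 + K\<^sub>2 * 2 + 2) 1 R" for R
  proof -
    \<comment> \<open>Both demands on \<open>m * x\<close> are met at once: \<open>R\<close> for the
      frequency and \<open>E\<close> for \<open>|\<epsilon>| \<le> x\<close>.\<close>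
    obtain M\<^sub>3 :: real where M3: "\<forall>m>0. M\<^sub>3 \<le> of_int m \<longrightarrow> max R E \<le> of_int m / sobolev_weight s m"
      by (rule rate_unbounded[OF \<open>s < 1\<close>])
    define N where "N = nat \<lceil>max M\<^sub>1 (max M\<^sub>2 M\<^sub>3)\<rceil>"
    obtain l m :: int where m: "m > 0" "int N \<le> m" and l: "\<bar>of_int l - r * of_int m\<bar> \<le> 2 / of_int m"
      by (rule Dirichlet_approx_large)
    have "real N \<le> of_int m" using of_int_le_iff[THEN iffD2, OF m(2)] by (simp only: of_int_of_nat_eq)
    then have "max M\<^sub>1 (max M\<^sub>2 M\<^sub>3) \<le> of_int m"
      unfolding N_def by (rule order_trans[OF real_nat_ceiling_ge])
    then have mM: "M\<^sub>1 \<le> of_int m" "M\<^sub>2 \<le> of_int m" "M\<^sub>3 \<le> of_int m" by auto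
    define e where "e = of_int l - r * of_int m"
    define \<epsilon> where "\<epsilon> = (\<alpha> * (of_int (l + m))\<^sup>2 - \<beta> * (of_int l)\<^sup>2 - \<gamma> * (of_int m)\<^sup>2) / of_int m"
    define W where "W = sobolev_weight s m"
    have W: "W > 0" by (simp add: W_def sobolev_weight_pos)
    define x where "x = 1 / W"
    have x: "x > 0" "W * x = 1" using W by (auto simp: x_def)
    have wk: "sobolev_weight s (l + m) \<le> K\<^sub>1 * W"
      unfolding W_def using K1(2) m(1) mM(1) l by (simp add: algebra_simps)
    have wl: "sobolev_weight s l \<le> K\<^sub>2 * W"
      unfolding W_def using K2(2) m(1) mM(2) l by simp
    have mx: "R \<le> of_int m * x" "E \<le> of_int m * x"
      using M3 m(1) mM(3) by (auto simp: x_def W_def)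
    have me: "of_int m * \<epsilon> = \<alpha> * (of_int (l + m))\<^sup>2 - \<beta> * (of_int l)\<^sup>2 - \<gamma> * (of_int m)\<^sup>2"
      using m by (simp add: \<epsilon>_def)
    \<comment> \<open>Taylor expansion of the resonance function around \<open>l = r * m\<close>;
      the quadratic term in \<open>m\<close> carries the polynomial that vanishes at
      \<open>r\<close>.\<close>
    also have "\<dots> = ((\<alpha> - \<beta>) * r\<^sup>2 + 2 * \<alpha> * r + (\<alpha> - \<gamma>)) * (of_int m)\<^sup>2
        + (2 * ((\<alpha> - \<beta>) * r + \<alpha>) * (e * of_int m) + (\<alpha> - \<beta>) * (e * e))"
    proof -
      have "of_int l = e + r * of_int m" by (simp add: e_def)
      then show ?thesis by (simp add: power2_eq_square algebra_simps)
    qed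
    finally have meq: "of_int m * \<epsilon> = 2 * ((\<alpha> - \<beta>) * r + \<alpha>) * (e * of_int m) + (\<alpha> - \<beta>) * (e * e)"
      using root by simp
    have em: "\<bar>e * of_int m\<bar> \<le> 2" using l m unfolding abs_mult e_def by (simp add: pos_le_divide_eq)
    have "2 / real_of_int m \<le> 2" using m by (intro two_divide_int_le) simp
    then have "\<bar>e\<bar> \<le> 2" using l by (simp add: e_def)
    then have "\<bar>e\<bar> * \<bar>e\<bar> \<le> 2 * 2" by (intro mult_mono) auto
    then have ee: "\<bar>e * e\<bar> \<le> 4" by (simp add: abs_mult)
    have "\<bar>of_int m * \<epsilon>\<bar> \<le> \<bar>2 * ((\<alpha> - \<beta>) * r + \<alpha>)\<bar> * \<bar>e * of_int m\<bar> + \<bar>\<alpha> - \<beta>\<bar> * \<bar>e * e\<bar>"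
      unfolding meq by (rule order_trans[OF abs_triangle_ineq]) (simp add: abs_mult)
    also have "\<dots> \<le> \<bar>2 * ((\<alpha> - \<beta>) * r + \<alpha>)\<bar> * 2 + \<bar>\<alpha> - \<beta>\<bar> * 4"
      using em ee by (intro add_mono mult_left_mono) auto
    also have "\<dots> \<le> of_int m * x" using mx(2) by (simp add: E_def)
    finally have \<epsilon>x: "\<bar>\<epsilon>\<bar> \<le> x" using m by (simp add: abs_mult)
    \<comment> \<open>With \<open>g = 1\<close> the factor of \<open>x\<^sup>2\<close> is 2, and
      \<open>|\<epsilon>| \<le> x\<close> keeps \<open>p\<close> between \<open>x\<close> and
      \<open>2 * x\<close>.\<close>
    define p where "p = sqrt (2 * x\<^sup>2 + \<epsilon> * x)"
    have "\<bar>\<epsilon> * x\<bar> \<le> x * x" using \<epsilon>x x by (simp add: abs_mult)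
    then have px: "x\<^sup>2 \<le> 2 * x\<^sup>2 + \<epsilon> * x" "2 * x\<^sup>2 + \<epsilon> * x \<le> (2 * x)\<^sup>2"
      unfolding power2_eq_square abs_le_iff by auto
    have p: "x \<le> p" "p \<le> 2 * x"
      unfolding p_def using px x by (auto intro: real_le_rsqrt real_le_lsqrt order_trans[OF zero_le_power2])
    have p2: "p\<^sup>2 = 2 * x\<^sup>2 + \<epsilon> * x"
      unfolding p_def using order_trans[OF zero_le_power2 px(1)] by simp
    have "sobolev_weight s (l + m) * x \<le> K\<^sub>1 * W * x"
      using wk x by (intro mult_right_mono) auto
    moreover have "sobolev_weight s l * p \<le> K\<^sub>2 * W * (2 * x)"
      using wl x p W K2(1) by (intro mult_mono) auto
    moreover have "W * p \<le> W * (2 * x)" using W p by (intro mult_left_mono) auto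
    ultimately have "sobolev_weight s (l + m) * x + sobolev_weight s l * p + W * p
        \<le> (K\<^sub>1 + K\<^sub>2 * 2 + 2) * (W * x)"
      by (simp add: algebra_simps)
    \<comment> \<open>Since \<open>W * x = 1\<close>, the component \<open>w\<close> has weighted
      amplitude at least 1; the phase is observed there, at frequency
      \<open>m * x \<ge> R\<close>.\<close>
    moreover have "W * x \<le> W * p" using W p by (intro mult_left_mono) auto
    ultimately show ?thesis
      using m x p p2 \<epsilon>x me mx
      by (intro resonant_triadI[where l = l and m = m and x = x and g = 1 and p = p and \<epsilon> = \<epsilon>])
        (simp_all add: W_def[symmetric])
  qed
  then show thesis by (rule that)
qed

text \<open>The resonance polynomial has a real root \<open>r\<close> when
  \<open>\<mu> \<le> 0\<close>. At the roots 0 and -1 the frequency of \<open>v\<close> or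
  \<open>u\<close> would stay bounded; 0 is a root only for \<open>\<alpha> = \<gamma>\<close> and
  -1 only for \<open>\<beta> = - \<gamma>\<close>. The exactly resonant triads cover the first case,
  and the second when \<open>s \<le> 0\<close>.\<close>

lemma resonant_triad_exists:
  fixes \<alpha> \<beta> \<gamma> \<mu> s :: real
  assumes "\<alpha> \<noteq> 0" and "\<beta> \<noteq> 0" and "\<gamma> \<noteq> 0"
    and \<mu>: "\<mu> = \<alpha> * \<beta> * \<gamma> * (1 / \<alpha> - 1 / \<beta> - 1 / \<gamma>)"
    and cases: "(\<alpha> - \<gamma> = 0 \<and> s \<ge> 0) \<or> (\<mu> \<le> 0 \<and> s < 1)"
  obtains K where "\<And>R. resonant_triad \<alpha> \<beta> \<gamma> s K 1 R"
proof (cases "\<alpha> = \<gamma>")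
  case True
  then show thesis
    using that[of 5] resonant_triad_const_v_pos resonant_triad_const_v_neg linear[of s 0] by metis
next
  case False
  with cases have "\<mu> \<le> 0" and s: "s < 1" by auto
  have \<mu>': "\<mu> = \<beta> * \<gamma> - \<alpha> * \<gamma> - \<alpha> * \<beta>" unfolding \<mu> using assms(1-3) by (simp add: field_simps)
  show thesis
  proof (cases "\<beta> = - \<gamma> \<and> s \<le> 0")
    case True
    then show thesis using that[of 5] resonant_triad_const_u by simp
  next
    case nondeg: False
    have "\<exists>r. (\<alpha> - \<beta>) * r\<^sup>2 + 2 * \<alpha> * r + (\<alpha> - \<gamma>) = 0"
    proof (cases "\<alpha> = \<beta>")
      case True
      then show ?thesis using \<open>\<alpha> \<noteq> 0\<close> by (intro exI[of _ "- (\<alpha> - \<gamma>) / (2 * \<alpha>)"]) simp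
    next
      case False
      \<comment> \<open>Completing the square: \<open>(\<alpha> - \<beta>) * r + \<alpha>\<close>
        must be a square root of \<open>- \<mu>\<close>.\<close>
      define r where "r = (sqrt (- \<mu>) - \<alpha>) / (\<alpha> - \<beta>)"
      have "((\<alpha> - \<beta>) * r + \<alpha>)\<^sup>2 = - \<mu>" using False \<open>\<mu> \<le> 0\<close> by (simp add: r_def)
      then have "(\<alpha> - \<beta>) * ((\<alpha> - \<beta>) * r\<^sup>2 + 2 * \<alpha> * r + (\<alpha> - \<gamma>)) = 0"
        unfolding \<mu>' by (simp add: power2_eq_square algebra_simps)
      then show ?thesis using False by auto
    qed
    then obtain r where r: "(\<alpha> - \<beta>) * r\<^sup>2 + 2 * \<alpha> * r + (\<alpha> - \<gamma>) = 0" by blast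
    \<comment> \<open>At 0 and -1 the polynomial takes the values \<open>\<alpha> - \<gamma>\<close>
      and \<open>- \<beta> - \<gamma>\<close>.\<close>
    have "s \<ge> 0 \<or> r \<noteq> 0 \<and> r \<noteq> - 1" using r False nondeg by auto
    then show thesis using resonant_triad_root[OF s r] that by blast
  qed
qed

theorem theorem1p12:
  fixes \<alpha> \<beta> \<gamma> \<mu> s :: real
  assumes "\<alpha> \<noteq> 0" and "\<beta> \<noteq> 0" and "\<gamma> \<noteq> 0"
    and "\<mu> = \<alpha> * \<beta> * \<gamma> * (1 / \<alpha> - 1 / \<beta> - 1 / \<gamma>)"
    and "(\<alpha> - \<gamma> = 0 \<and> s \<ge> 0) \<or> (\<mu> \<le> 0 \<and> s < 1)"
  shows "\<exists>(u :: nat \<Rightarrow> real \<Rightarrow> real^'n \<Rightarrow> complex^'n) v w u' v' w' (t :: nat \<Rightarrow> real) (C :: real) (c :: real).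
    C > 0 \<and> c > 0 \<and>
    (\<forall>n. t n > 0) \<and>
    (\<forall>n. classical_solution_up_to \<alpha> \<beta> \<gamma> (t n) (u n) (v n) (w n)) \<and>
    (\<forall>n. classical_solution_up_to \<alpha> \<beta> \<gamma> (t n) (u' n) (v' n) (w' n)) \<and>
    t \<longlonglongrightarrow> 0 \<and>
    (SUP n. Hs_norm s (u n 0) (v n 0) (w n 0) + Hs_norm s (u' n 0) (v' n 0) (w' n 0)) \<le> ereal C \<and>
    (\<lambda>n. Hs_norm s (\<lambda>x. u n 0 x - u' n 0 x) (\<lambda>x. v n 0 x - v' n 0 x) (\<lambda>x. w n 0 x - w' n 0 x))
      \<longlonglongrightarrow> 0 \<and>
    (\<exists>L. (\<lambda>n. Hs_norm s (\<lambda>x. u n (t n) x - u' n (t n) x) (\<lambda>x. v n (t n) x - v' n (t n) x)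
              (\<lambda>x. w n (t n) x - w' n (t n) x)) \<longlonglongrightarrow> L \<and> L \<ge> ereal c)"
proof -
  obtain K where "\<And>R. resonant_triad \<alpha> \<beta> \<gamma> s K 1 R"
    using resonant_triad_exists[OF assms] by blast
  then show ?thesis
    by (intro failure_from_resonant_triads[of 1]) simp_all
qed

end
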